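(* Let $M$ be Hrushovski's countable non-collapsed structure for a symmetric ternary relation $R$, let $S$ be the ternary relation on $M$ defined by $$S(x_1,x_2,x_3):\iff \exists x_4,x_5\Big(\bigwedge_{i\in\{1,2,3\}} R(x_i,x_4,x_5)\Big)\wedge\bigwedge_{i\neq j}x_i\neq x_j ,$$ and let $M_s=(M;S)$ be the reduct of $M$ to $S$. Then $M_s$ is a proper reduct of $M$: the relation $R$ cannot be recovered from $S$, i.e. $R$ is not definable (without parameters) in the structure $M_s$.
   Context: An $R$-structure is a set with a symmetric (invariant under permutation of variables) ternary relation $R$ that holds only of triples of pairwise distinct elements; substructures are induced. For a finite $R$-structure $A$ let $r(A)$ be the number of three-element subsets $\{x,y,z\}\subseteq A$ with $R(x,y,z)$, and $d_0(A)=|A|-r(A)$. For $A\subseteq N$ with $A$ finite, $A\leqslant N$ ("$A$ is strong in $N$") means $d_0(B)\ge d_0(A)$ for every finite $B$ with $A\subseteq B\subseteq N$. Let $\mathcal{C}$ be the class of finite $R$-structures $A$ with $\emptyset\leqslant A$. Hrushovski's non-collapsed structure $M$ is the Fraïssé limit of $\mathcal{C}$ with respect to $\leqslant$: the unique (up to isomorphism) countable $R$-structure all of whose finite substructures are in $\mathcal{C}$ and such that whenever $A\leqslant M$ is finite and $A\leqslant B\in\mathcal{C}$, there is an embedding $f:B\to M$ with $f\upharpoonright A=\mathrm{id}_A$ and $f(B)\leqslant M$. *)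

theory Defs
  imports Main "HOL-Library.Countable_Set"
begin

text \<open>
  A structure for one ternary relation symbol is given by a carrier set and a ternary predicate
  on the ambient type.
\<close>

definition r_structure :: "'a set \<Rightarrow> ('a \<Rightarrow> 'a \<Rightarrow> 'a \<Rightarrow> bool) \<Rightarrow> bool" where
  "r_structure N R \<longleftrightarrow>
     (\<forall>x y z. R x y z \<longrightarrow>
        x \<in> N \<and> y \<in> N \<and> z \<in> N \<and> x \<noteq> y \<and> x \<noteq> z \<and> y \<noteq> z \<and>
        R x z y \<and> R y x z \<and> R y z x \<and> R z x y \<and> R z y x)"

definition induced :: "'a set \<Rightarrow> ('a \<Rightarrow> 'a \<Rightarrow> 'a \<Rightarrow> bool) \<Rightarrow> 'a \<Rightarrow> 'a \<Rightarrow> 'a \<Rightarrow> bool" where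
  "induced A R x y z \<longleftrightarrow> x \<in> A \<and> y \<in> A \<and> z \<in> A \<and> R x y z"

definition r_count :: "('a \<Rightarrow> 'a \<Rightarrow> 'a \<Rightarrow> bool) \<Rightarrow> 'a set \<Rightarrow> nat" where
  "r_count R A = card {{x, y, z} | x y z. x \<in> A \<and> y \<in> A \<and> z \<in> A \<and> R x y z}"

definition d0 :: "('a \<Rightarrow> 'a \<Rightarrow> 'a \<Rightarrow> bool) \<Rightarrow> 'a set \<Rightarrow> int" where
  "d0 R A = int (card A) - int (r_count R A)"

definition strong :: "('a \<Rightarrow> 'a \<Rightarrow> 'a \<Rightarrow> bool) \<Rightarrow> 'a set \<Rightarrow> 'a set \<Rightarrow> bool" where
  "strong R A N \<longleftrightarrow>
     finite A \<and> A \<subseteq> N \<and> (\<forall>B. finite B \<and> A \<subseteq> B \<and> B \<subseteq> N \<longrightarrow> d0 R A \<le> d0 R B)"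

definition class_C :: "'a set \<Rightarrow> ('a \<Rightarrow> 'a \<Rightarrow> 'a \<Rightarrow> bool) \<Rightarrow> bool" where
  "class_C A R \<longleftrightarrow> finite A \<and> r_structure A R \<and> strong R {} A"

definition embedding ::
  "'a set \<Rightarrow> ('a \<Rightarrow> 'a \<Rightarrow> 'a \<Rightarrow> bool) \<Rightarrow> 'b set \<Rightarrow> ('b \<Rightarrow> 'b \<Rightarrow> 'b \<Rightarrow> bool) \<Rightarrow> ('a \<Rightarrow> 'b) \<Rightarrow> bool" where
  "embedding A R B R' f \<longleftrightarrow>
     f ` A \<subseteq> B \<and> inj_on f A \<and>
     (\<forall>x\<in>A. \<forall>y\<in>A. \<forall>z\<in>A. R x y z \<longleftrightarrow> R' (f x) (f y) (f z))"

text \<open>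
  In the extension property, the inclusion of \<open>A\<close> in \<open>B\<close> is replaced by an embedding \<open>e\<close> of \<open>A\<close>
  onto a strong substructure of \<open>B\<close>. This lets \<open>B\<close> range over structures on finite sets of
  natural numbers, hence over all finite structures up to isomorphism over \<open>A\<close>, whatever the
  cardinality of the ambient type of \<open>M\<close>. The condition \<open>f (e a) = a\<close> then says that \<open>f\<close> is the
  identity on \<open>A\<close>.
\<close>

definition hrushovski_generic :: "'a set \<Rightarrow> ('a \<Rightarrow> 'a \<Rightarrow> 'a \<Rightarrow> bool) \<Rightarrow> bool" where
  "hrushovski_generic M R \<longleftrightarrow>
     countable M \<and> r_structure M R \<and>
     (\<forall>A. finite A \<and> A \<subseteq> M \<longrightarrow> class_C A (induced A R)) \<and>
     (\<forall>A (B :: nat set) R' e.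
        strong R A M \<and> class_C B R' \<and> embedding A R B R' e \<and> strong R' (e ` A) B \<longrightarrow>
        (\<exists>f. embedding B R' M R f \<and> (\<forall>a\<in>A. f (e a) = a) \<and> strong R (f ` B) M))"

definition S_rel ::
  "'a set \<Rightarrow> ('a \<Rightarrow> 'a \<Rightarrow> 'a \<Rightarrow> bool) \<Rightarrow> 'a \<Rightarrow> 'a \<Rightarrow> 'a \<Rightarrow> bool" where
  "S_rel M R x1 x2 x3 \<longleftrightarrow>
     x1 \<in> M \<and> x2 \<in> M \<and> x3 \<in> M \<and>
     (\<exists>x4\<in>M. \<exists>x5\<in>M. R x1 x4 x5 \<and> R x2 x4 x5 \<and> R x3 x4 x5) \<and>
     x1 \<noteq> x2 \<and> x1 \<noteq> x3 \<and> x2 \<noteq> x3"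

text \<open>
  First-order formulas with equality over a single ternary relation symbol. Variables are
  natural numbers, and \<open>FEx n\<close> binds the variable \<open>n\<close>.
\<close>

datatype fm =
    FEq nat nat
  | FRel nat nat nat
  | FNeg fm
  | FConj fm fm
  | FEx nat fm

primrec fv :: "fm \<Rightarrow> nat set" where
  "fv (FEq i j) = {i, j}"
| "fv (FRel i j k) = {i, j, k}"
| "fv (FNeg p) = fv p"
| "fv (FConj p q) = fv p \<union> fv q"
| "fv (FEx n p) = fv p - {n}"

primrec sat :: "'a set \<Rightarrow> ('a \<Rightarrow> 'a \<Rightarrow> 'a \<Rightarrow> bool) \<Rightarrow> (nat \<Rightarrow> 'a) \<Rightarrow> fm \<Rightarrow> bool" where
  "sat M P v (FEq i j) \<longleftrightarrow> v i = v j"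
| "sat M P v (FRel i j k) \<longleftrightarrow> P (v i) (v j) (v k)"
| "sat M P v (FNeg p) \<longleftrightarrow> \<not> sat M P v p"
| "sat M P v (FConj p q) \<longleftrightarrow> sat M P v p \<and> sat M P v q"
| "sat M P v (FEx n p) \<longleftrightarrow> (\<exists>a\<in>M. sat M P (v(n := a)) p)"

text \<open>
  \<open>definable M P Q\<close>: the ternary relation \<open>Q\<close> on \<open>M\<close> is definable without parameters in the
  structure \<open>(M; P)\<close>.
\<close>

definition definable ::
  "'a set \<Rightarrow> ('a \<Rightarrow> 'a \<Rightarrow> 'a \<Rightarrow> bool) \<Rightarrow> ('a \<Rightarrow> 'a \<Rightarrow> 'a \<Rightarrow> bool) \<Rightarrow> bool" where
  "definable M P Q \<longleftrightarrow>
     (\<exists>\<phi>. fv \<phi> \<subseteq> {0, 1, 2} \<and>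
        (\<forall>v. range v \<subseteq> M \<longrightarrow> (Q (v 0) (v 1) (v 2) \<longleftrightarrow> sat M P v \<phi>)))"

end

theory Submission
  imports Defs
begin

text \<open>
  Definability of \<open>S\<close> from \<open>R\<close> is its definition written as a formula. For the converse, regard \<open>M\<close>
  as an incidence structure with two sorts: points are the elements of \<open>M\<close>, lines are the
  two-element subsets of \<open>M\<close>, and \<open>x\<close> lies on \<open>{a, b}\<close> when \<open>R x a b\<close>. Then \<open>S\<close> says that three
  distinct points lie on a common line. What this structure forgets is which pair of points a
  line is, and the proof shows that this cannot be recovered: a triple in \<open>R\<close> and a triple outside
  \<open>R\<close> satisfy the same formulas, even in the two-sorted structure, as long as each triple is
  strong in \<open>M\<close>.

  Give a finite set \<open>X\<close> of points and a finite set \<open>Y\<close> of lines the predimension \<open>ldim\<close>, which is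
  \<open>|X| + 2|Y|\<close> minus the number of incidences. A line has weight \<open>2\<close> because it costs two elements of
  \<open>M\<close>, and an incidence has weight \<open>1\<close> because it costs one triple. A pair \<open>(X, Y)\<close> is called
  strong (\<open>lstrong\<close>) if no finite extension has smaller predimension. The point of the proof is
  that the incidence structure of \<open>M\<close> is itself generic for this predimension.

  Two lemmas relate the two predimensions. \<open>ldim_restrict_strong\<close> states that restricting \<open>(X, Y)\<close>
  to a set that is strong in \<open>M\<close> does not increase \<open>ldim\<close>. One triple of \<open>R\<close> can carry three incidences, so this
  is not a comparison term by term; it is proved by weighting each element of \<open>M\<close> with
  the number of members of \<open>(X, Y)\<close> that it belongs to, and applying strongness to every level set of
  the weight. In the other direction, an abstract strong extension of incidence structures is
  realized by adding every new line to \<open>M\<close> as a pair of two entirely new elements. This extension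
  is strong for the predimension of \<open>M\<close> (\<open>card_new_triples_le\<close>), so it embeds in \<open>M\<close>, and the image
  is strong again (\<open>lstrong_realization\<close>).

  Consequently isomorphisms between strong pairs \<open>(X, Y)\<close> form a back-and-forth system
  (\<open>partial_iso_extend\<close>), and valuations that correspond under such an isomorphism satisfy the same
  formulas about \<open>S\<close> (\<open>similar_sat\<close>). Finally, a triple that is strong in \<open>M\<close> is strong as a set of
  three points without lines, whether or not it is in \<open>R\<close> (\<open>lstrong_three_points\<close>). Hence any
  bijection between a related and an unrelated strong triple belongs to the system, and no formula
  about \<open>S\<close> can define \<open>R\<close>.
\<close>

section \<open>Predimension of the point-line incidence structure\<close>

definition triples :: "('a \<Rightarrow> 'a \<Rightarrow> 'a \<Rightarrow> bool) \<Rightarrow> 'a set set" where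
  "triples R = {{x, y, z} | x y z. R x y z}"

definition lines :: "'a set \<Rightarrow> 'a set set" where
  "lines M = {y. y \<subseteq> M \<and> card y = 2}"

text \<open>
  The incident pairs of a point and a line. For a line \<open>y = {a, b}\<close>, membership of
  \<open>insert x y\<close> in \<open>triples R\<close> means \<open>R x a b\<close>; in
  particular \<open>x\<close> is then different from \<open>a\<close> and \<open>b\<close>.
\<close>

definition flags :: "('a \<Rightarrow> 'a \<Rightarrow> 'a \<Rightarrow> bool) \<Rightarrow> 'a set \<Rightarrow> 'a set set \<Rightarrow> ('a \<times> 'a set) set" where
  "flags R X Y = {(x, y). x \<in> X \<and> y \<in> Y \<and> insert x y \<in> triples R}"

definition ldim :: "('a \<Rightarrow> 'a \<Rightarrow> 'a \<Rightarrow> bool) \<Rightarrow> 'a set \<Rightarrow> 'a set set \<Rightarrow> int" where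
  "ldim R X Y = int (card X) + 2 * int (card Y) - int (card (flags R X Y))"

definition lstrong :: "'a set \<Rightarrow> ('a \<Rightarrow> 'a \<Rightarrow> 'a \<Rightarrow> bool) \<Rightarrow> 'a set \<Rightarrow> 'a set set \<Rightarrow> bool" where
  "lstrong M R X Y \<longleftrightarrow>
     finite X \<and> finite Y \<and> X \<subseteq> M \<and> Y \<subseteq> lines M \<and>
     (\<forall>X' Y'. finite X' \<and> finite Y' \<and> X \<subseteq> X' \<and> Y \<subseteq> Y' \<and> X' \<subseteq> M \<and> Y' \<subseteq> lines M \<longrightarrow>
        ldim R X Y \<le> ldim R X' Y')"

lemma lstrong_le:
  assumes "lstrong M R X Y" "finite X'" "finite Y'" "X \<subseteq> X'" "Y \<subseteq> Y'" "X' \<subseteq> M" "Y' \<subseteq> lines M"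
  shows "ldim R X Y \<le> ldim R X' Y'"
  using assms unfolding lstrong_def by blast

lemma r_count_triples: "r_count R A = card {t \<in> triples R. t \<subseteq> A}"
proof -
  have "{{x, y, z} | x y z. x \<in> A \<and> y \<in> A \<and> z \<in> A \<and> R x y z} = {t \<in> triples R. t \<subseteq> A}"
    unfolding triples_def by blast
  thus ?thesis by (simp add: r_count_def)
qed

lemma finite_triples_within: "finite A \<Longrightarrow> finite {t \<in> T. t \<subseteq> A \<and> P t}"
  by (rule finite_subset[of _ "Pow A"]) auto

lemma finite_triples_within': "finite A \<Longrightarrow> finite {t \<in> T. t \<subseteq> A}"
  by (rule finite_subset[of _ "Pow A"]) auto

lemma triples_card:
  assumes "r_structure M R" "t \<in> triples R"
  shows "card t = 3" "t \<subseteq> M"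
proof -
  obtain x y z where t: "t = {x, y, z}" "R x y z" using assms(2) by (auto simp: triples_def)
  hence "x \<in> M \<and> y \<in> M \<and> z \<in> M \<and> x \<noteq> y \<and> x \<noteq> z \<and> y \<noteq> z"
    using assms(1) unfolding r_structure_def by blast
  thus "card t = 3" "t \<subseteq> M" by (auto simp: t(1))
qed

lemma triple_iff:
  assumes "r_structure M R"
  shows "{x, y, z} \<in> triples R \<longleftrightarrow> R x y z"
proof
  assume "{x, y, z} \<in> triples R"
  then obtain a b c where abc: "{x, y, z} = {a, b, c}" "R a b c"
    unfolding triples_def by blast
  have "card {x, y, z} = 3"
    using triples_card(1)[OF assms, of "{a, b, c}"] abc unfolding triples_def by auto
  hence "x \<noteq> y" "x \<noteq> z" "y \<noteq> z" by (auto simp: card_insert_if split: if_splits)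
  moreover have "x \<in> {a, b, c}" "y \<in> {a, b, c}" "z \<in> {a, b, c}"
    using abc(1) by (simp_all flip: abc(1))
  moreover have "R a b c \<and> R a c b \<and> R b a c \<and> R b c a \<and> R c a b \<and> R c b a"
    using assms abc(2) unfolding r_structure_def by blast
  ultimately show "R x y z" by auto
qed (auto simp: triples_def)

lemma flag_point_notin_line:
  assumes "r_structure M R" "card y = 2" "insert x y \<in> triples R"
  shows "x \<notin> y"
  using triples_card(1)[OF assms(1,3)] assms(2) by (auto simp: insert_absorb)

lemma finite_flags: "finite X \<Longrightarrow> finite Y \<Longrightarrow> finite (flags R X Y)"
  by (rule finite_subset[of _ "X \<times> Y"]) (auto simp: flags_def)

text \<open>
  Summation by level sets: it reduces an inequality between two sums over weights to an
  inequality between cardinalities, which is what strongness provides.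
\<close>

lemma layer_cake:
  fixes w :: "'b \<Rightarrow> nat"
  assumes "finite A" "\<And>x. x \<in> A \<Longrightarrow> w x \<le> N"
  shows "(\<Sum>x\<in>A. w x) = (\<Sum>k<N. card {x \<in> A. k < w x})"
proof -
  have "w x = (\<Sum>k<N. if k < w x then 1 else 0)" if "x \<in> A" for x
  proof -
    have "{..<N} \<inter> {k. k < w x} = {..<w x}" using assms(2)[OF that] by auto
    thus ?thesis by (simp add: sum.If_cases)
  qed
  hence "(\<Sum>x\<in>A. w x) = (\<Sum>x\<in>A. \<Sum>k<N. if k < w x then 1 else 0)" by simp
  also have "\<dots> = (\<Sum>k<N. \<Sum>x\<in>A. if k < w x then 1 else 0)" by (rule sum.swap)
  also have "\<dots> = (\<Sum>k<N. card {x \<in> A. k < w x})"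
    using assms(1) by (simp add: sum.If_cases Int_def)
  finally show ?thesis .
qed

lemma strong_new_triples:
  assumes "strong R D M" "finite U" "U \<subseteq> M"
  shows "card {t \<in> triples R. t \<subseteq> D \<union> U \<and> \<not> t \<subseteq> D} \<le> card (U - D)"
proof -
  have fD: "finite D" using assms(1) by (simp add: strong_def)
  have "d0 R D \<le> d0 R (D \<union> U)" using assms fD unfolding strong_def by auto
  moreover have "card (D \<union> U) = card D + card (U - D)"
    using fD assms(2) by (metis Un_Diff_cancel card_Un_disjoint Diff_disjoint finite_Diff)
  moreover have "{t \<in> triples R. t \<subseteq> D \<union> U}
      = {t \<in> triples R. t \<subseteq> D} \<union> {t \<in> triples R. t \<subseteq> D \<union> U \<and> \<not> t \<subseteq> D}" by auto
  hence "card {t \<in> triples R. t \<subseteq> D \<union> U}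
      = card {t \<in> triples R. t \<subseteq> D} + card {t \<in> triples R. t \<subseteq> D \<union> U \<and> \<not> t \<subseteq> D}"
    using fD assms(2) by (subst card_Un_disjoint[symmetric])
      (auto intro: finite_triples_within finite_triples_within')
  ultimately show ?thesis unfolding d0_def r_count_triples by linarith
qed

text \<open>
  All incidences carried by one triple \<open>t\<close> involve any given element
  \<open>v\<close> of \<open>t\<close>: in each of them \<open>v\<close> is the point or belongs
  to the line. The bound is the weight of \<open>v\<close> in the proof below.
\<close>

lemma card_flags_on_triple_le:
  assumes "r_structure M R" "finite X" "finite Y" "Y \<subseteq> lines M" "v \<in> t"
  shows "card {p \<in> flags R X Y. insert (fst p) (snd p) = t}
    \<le> card {y \<in> Y. v \<in> y} + (if v \<in> X then 1 else 0)"
proof -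
  let ?F = "{p \<in> flags R X Y. insert (fst p) (snd p) = t}"
  \<comment> \<open>An incidence on \<open>t\<close> is determined by its line; \<open>None\<close> marks the only one with point \<open>v\<close>.\<close>
  let ?h = "\<lambda>p. if fst p = v then None else Some (snd p)"
  let ?G = "Some ` {y \<in> Y. v \<in> y} \<union> (if v \<in> X then {None} else {})"
  have notin: "fst p \<notin> snd p" if "p \<in> ?F" for p
    using that assms(4) flag_point_notin_line[OF assms(1), of "snd p" "fst p"]
    by (auto simp: flags_def lines_def)
  have inj: "inj_on ?h ?F"
  proof (rule inj_onI)
    fix p q assume pq: "p \<in> ?F" "q \<in> ?F" "?h p = ?h q"
    have *: "insert (fst p) (snd p) = insert (fst q) (snd q)" using pq by auto
    show "p = q"
    proof (cases "fst p = v")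
      case True
      hence "fst q = v" using pq(3) by (auto split: if_splits)
      thus ?thesis using True * notin[OF pq(1)] notin[OF pq(2)]
        by (metis insert_ident prod.expand)
    next
      case False
      hence "snd p = snd q" using pq(3) by (auto split: if_splits)
      thus ?thesis using * notin[OF pq(1)] notin[OF pq(2)]
        by (metis insertE insertI1 prod.expand)
    qed
  qed
  have "?h p \<in> ?G" if "p \<in> ?F" for p
  proof -
    obtain x y where p: "p = (x, y)" by fastforce
    hence "x \<in> X" "y \<in> Y" "v \<in> insert x y" using that assms(5) by (auto simp: flags_def)
    thus ?thesis by (cases "x = v") (simp_all add: p image_iff)
  qed
  hence "?h ` ?F \<subseteq> ?G" by blast
  moreover have "finite ?G" using assms(3) by simp
  ultimately have "card ?F \<le> card ?G" using inj by (intro card_inj_on_le)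
  also have "card ?G = card {y \<in> Y. v \<in> y} + (if v \<in> X then 1 else 0)"
    using assms(3) by (simp add: card_image inj_on_def card_insert_if image_iff)
  finally show ?thesis .
qed

text \<open>
  Let the weight of \<open>v\<close> count the points and lines of \<open>(X, Y)\<close> that
  \<open>v\<close> belongs to. A triple with more than \<open>k\<close> incidences has all its
  elements in the level set of weight greater than \<open>k\<close>, and since \<open>D\<close>
  is strong, adding such a level set to \<open>D\<close> creates at most as many triples as it
  adds elements. Summing over \<open>k\<close>, the incidences lost by restricting to
  \<open>D\<close> number at most the total weight outside \<open>D\<close>, and a lost point
  contributes at most \<open>1\<close> to this weight, a lost line at most \<open>2\<close>.
\<close>

lemma ldim_restrict_strong:
  assumes "r_structure M R" "strong R D M" "finite X" "finite Y" "X \<subseteq> M" "Y \<subseteq> lines M"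
  shows "ldim R (X \<inter> D) (Y \<inter> Pow D) \<le> ldim R X Y"
proof -
  define w where "w v = card {y \<in> Y. v \<in> y} + (if v \<in> X then 1 else 0)" for v
  define W where "W = X \<union> \<Union>Y"
  define T where "T = {t \<in> triples R. t \<subseteq> D \<union> W \<and> \<not> t \<subseteq> D}"
  define i where "i t = card {p \<in> flags R X Y. insert (fst p) (snd p) = t}" for t
  define N where "N = card Y + 1 + card (flags R X Y)"
  have fD: "finite D" using assms(2) by (simp add: strong_def)
  have fy: "finite y" "card y = 2" "y \<subseteq> M" if "y \<in> Y" for y
    using that assms(6) by (auto simp: lines_def intro!: card_ge_0_finite)
  have fW: "finite W" "W \<subseteq> M" using assms(3-5) fy unfolding W_def by (blast intro: finite_Union)+
  have fT: "finite T" unfolding T_def using fD fW by (intro finite_triples_within) auto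
  have ff: "finite (flags R X Y)" using assms(3,4) by (rule finite_flags)
  have wN: "w v \<le> N" for v
    using card_mono[of Y "{y \<in> Y. v \<in> y}"] assms(4) by (auto simp: w_def N_def)
  have iN: "i t \<le> N" for t
    using card_mono[OF ff, of "{p \<in> flags R X Y. insert (fst p) (snd p) = t}"]
    by (auto simp: i_def N_def)
  have iw: "i t \<le> w v" if "v \<in> t" for t v
    using card_flags_on_triple_le[OF assms(1,3,4,6) that] by (simp add: i_def w_def)
  have old: "flags R (X \<inter> D) (Y \<inter> Pow D) \<subseteq> flags R X Y" by (auto simp: flags_def)
  have split: "flags R X Y - flags R (X \<inter> D) (Y \<inter> Pow D)
      = (\<Union>t\<in>T. {p \<in> flags R X Y. insert (fst p) (snd p) = t})"
    by (auto simp: flags_def T_def W_def)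
  have "card (flags R X Y) - card (flags R (X \<inter> D) (Y \<inter> Pow D)) = (\<Sum>t\<in>T. i t)"
    unfolding i_def using fT ff
    by (subst card_Diff_subset[symmetric, OF finite_subset[OF old ff] old], subst split)
       (rule card_UN_disjoint; auto)
  also have "\<dots> = (\<Sum>k<N. card {t \<in> T. k < i t})"
    using fT iN by (rule layer_cake)
  also have "\<dots> \<le> (\<Sum>k<N. card {v \<in> W - D. k < w v})"
  proof (rule sum_mono)
    fix k
    let ?U = "{v \<in> W - D. k < w v}"
    have "{t \<in> T. k < i t} \<subseteq> {t \<in> triples R. t \<subseteq> D \<union> ?U \<and> \<not> t \<subseteq> D}"
    proof safe
      fix t v assume "t \<in> T" "k < i t" "v \<in> t" "v \<notin> D"
      moreover have "k < w v" using iw[OF \<open>v \<in> t\<close>] \<open>k < i t\<close> by linarith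
      ultimately show "v \<in> W" "k < w v" by (auto simp: T_def)
    qed (auto simp: T_def)
    hence "card {t \<in> T. k < i t} \<le> card {t \<in> triples R. t \<subseteq> D \<union> ?U \<and> \<not> t \<subseteq> D}"
      using fD fW by (intro card_mono finite_triples_within) auto
    also have "\<dots> \<le> card (?U - D)"
      using fW by (intro strong_new_triples[OF assms(2)]) auto
    also have "?U - D = ?U" by auto
    finally show "card {t \<in> T. k < i t} \<le> card ?U" .
  qed
  also have "\<dots> = (\<Sum>v\<in>W-D. w v)"
    using fW wN by (intro layer_cake[symmetric]) auto
  also have "\<dots> = (\<Sum>v\<in>W-D. card {y \<in> Y. v \<in> y}) + (\<Sum>v\<in>W-D. if v \<in> X then 1 else 0)"
    by (simp add: w_def sum.distrib)
  also have "(\<Sum>v\<in>W-D. if v \<in> X then 1 else 0) = card (X - D)"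
  proof -
    have "(W - D) \<inter> X = X - D" by (auto simp: W_def)
    thus ?thesis using fW by (simp add: sum.If_cases Int_def)
  qed
  also have "(\<Sum>v\<in>W-D. card {y \<in> Y. v \<in> y}) = (\<Sum>y\<in>Y. card {v \<in> W - D. v \<in> y})"
    using sum.swap[of "\<lambda>v y. if v \<in> y then 1 else (0::nat)" Y "W - D"] fW assms(4)
    by (simp add: sum.If_cases Int_def)
  also have "(\<Sum>y\<in>Y. card {v \<in> W - D. v \<in> y}) \<le> (\<Sum>y\<in>Y. if y \<in> Pow D then 0 else 2)"
  proof (rule sum_mono)
    fix y assume y: "y \<in> Y"
    have "card {v \<in> W - D. v \<in> y} \<le> card y" using fy[OF y] by (intro card_mono) auto
    moreover have "{v \<in> W - D. v \<in> y} = {}" if "y \<subseteq> D" using that by auto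
    ultimately show "card {v \<in> W - D. v \<in> y} \<le> (if y \<in> Pow D then 0 else 2)"
      using fy[OF y] by (auto simp: subset_iff)
  qed
  also have "(\<Sum>y\<in>Y. if y \<in> Pow D then 0 else 2) = 2 * card (Y - Pow D)"
    using assms(4) by (simp add: sum.If_cases Diff_eq Pow_def)
  finally have "card (flags R X Y) - card (flags R (X \<inter> D) (Y \<inter> Pow D))
      \<le> 2 * card (Y - Pow D) + card (X - D)" by simp
  moreover have "card X = card (X \<inter> D) + card (X - D)"
    using assms(3) by (metis Int_Diff_Un Int_Diff_disjoint card_Un_disjoint finite_Diff finite_Int)
  moreover have "card Y = card (Y \<inter> Pow D) + card (Y - Pow D)"
    using assms(4) by (metis Int_Diff_Un Int_Diff_disjoint card_Un_disjoint finite_Diff finite_Int)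
  ultimately show ?thesis unfolding ldim_def by linarith
qed

section \<open>Realizing finite extensions in the generic structure\<close>

lemma generic_r_structure: "hrushovski_generic M R \<Longrightarrow> r_structure M R"
  by (simp add: hrushovski_generic_def)

lemma generic_d0_nonneg:
  assumes "hrushovski_generic M R" "finite A" "A \<subseteq> M"
  shows "0 \<le> d0 R A"
proof -
  have "strong (induced A R) {} A"
    using assms by (simp add: hrushovski_generic_def class_C_def)
  hence "d0 (induced A R) {} \<le> d0 (induced A R) A" using assms(2) by (simp add: strong_def)
  moreover have "d0 (induced A R) {} = 0" by (simp add: d0_def r_count_def)
  moreover have "d0 (induced A R) A = d0 R A"
    by (auto simp: d0_def r_count_def induced_def intro!: arg_cong[where f = card])
  ultimately show ?thesis by simp
qed

lemma image_subset_image_iff: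
  assumes "inj_on f D" "A \<subseteq> D" "B \<subseteq> D"
  shows "f ` A \<subseteq> f ` B \<longleftrightarrow> A \<subseteq> B"
  using assms by (auto simp: subset_iff image_iff) (metis inj_onD)

text \<open>
  The extension property of the generic structure for a finite set \<open>D\<close> of any type
  and an abstract set \<open>T\<close> of triples on it. The assumption \<open>new\<close> is
  what makes \<open>D\<close> a strong extension of the copy of \<open>C\<close>; because it is
  required for every \<open>U\<close>, also those that do not contain the copy of
  \<open>C\<close>, it shows at the same time that the empty set is strong in \<open>D\<close>.
\<close>

lemma generic_extension:
  fixes D :: "'b set" and T :: "'b set set"
  assumes gen: "hrushovski_generic M R" and C: "strong R C M"
    and D: "finite D" and T: "\<And>t. t \<in> T \<Longrightarrow> card t = 3 \<and> t \<subseteq> D"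
    and b: "inj_on b C" "b ` C \<subseteq> D"
    and old: "{t \<in> T. t \<subseteq> b ` C} = image b ` {t \<in> triples R. t \<subseteq> C}"
    and new: "\<And>U. U \<subseteq> D \<Longrightarrow> card {t \<in> T. t \<subseteq> U \<and> \<not> t \<subseteq> b ` C} \<le> card (U - b ` C)"
  obtains h where "inj_on h D" "\<And>c. c \<in> C \<Longrightarrow> h (b c) = c" "h ` D \<subseteq> M"
    "{t \<in> triples R. t \<subseteq> h ` D} = image h ` T" "strong R (h ` D) M"
proof -
  have rM: "r_structure M R" using gen by (rule generic_r_structure)
  have CM: "finite C" "C \<subseteq> M" using C by (auto simp: strong_def)
  \<comment> \<open>Genericity speaks of structures on natural numbers only, so the extension is coded there.\<close>
  obtain k :: "'b \<Rightarrow> nat" where k: "inj_on k D" using finite_imp_inj_to_nat_seg[OF D] by blast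
  have kT: "image k s \<in> image k ` T \<longleftrightarrow> s \<in> T" if "s \<subseteq> D" for s
    using that T by (intro inj_on_image_mem_iff[OF inj_on_image_Pow[OF k]]) auto
  define R' where "R' x y z \<longleftrightarrow> {x, y, z} \<in> image k ` T" for x y z
  have T3: "card t = 3 \<and> t \<subseteq> k ` D" if "t \<in> image k ` T" for t
    using that T k by (auto simp: card_image inj_on_subset)
  have tr: "triples R' = image k ` T"
  proof (rule subset_antisym; rule subsetI)
    fix t assume t: "t \<in> image k ` T"
    then obtain x y z where "t = {x, y, z}" using T3 card_3_iff by metis
    thus "t \<in> triples R'" using t unfolding triples_def R'_def by blast
  qed (auto simp: triples_def R'_def)
  have rB: "r_structure (k ` D) R'"
    unfolding r_structure_def
  proof (intro allI impI)
    fix x y z assume xyz: "R' x y z"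
    have 3: "card {x, y, z} = 3" "{x, y, z} \<subseteq> k ` D" using T3 xyz by (auto simp: R'_def)
    hence "x \<noteq> y" "x \<noteq> z" "y \<noteq> z" by (auto simp: card_insert_if split: if_splits)
    thus "x \<in> k ` D \<and> y \<in> k ` D \<and> z \<in> k ` D \<and> x \<noteq> y \<and> x \<noteq> z \<and> y \<noteq> z \<and>
        R' x z y \<and> R' y x z \<and> R' y z x \<and> R' z x y \<and> R' z y x"
      using 3(2) xyz by (simp add: R'_def insert_commute)
  qed
  have dim: "d0 R' (k ` U) = int (card U) - int (card {t \<in> T. t \<subseteq> U})" if U: "U \<subseteq> D" for U
  proof -
    have "{t \<in> triples R'. t \<subseteq> k ` U} = image k ` {t \<in> T. t \<subseteq> U}"
      unfolding tr using T U by (auto simp: image_subset_image_iff[OF k])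
    moreover have "inj_on (image k) {t \<in> T. t \<subseteq> U}"
      by (rule inj_on_subset[OF inj_on_image_Pow[OF k]]) (use U in auto)
    moreover have "card (k ` U) = card U" by (rule card_image[OF inj_on_subset[OF k U]])
    ultimately show ?thesis by (simp add: d0_def r_count_triples card_image)
  qed
  \<comment> \<open>Passing from \<open>U\<close> to its part in the copy of \<open>C\<close> does not increase the predimension. This yields
    both that the empty set is strong and that the copy of \<open>C\<close> is strong.\<close>
  have bound: "int (card (U \<inter> b ` C)) - int (card {t \<in> T. t \<subseteq> U \<inter> b ` C}) \<le> d0 R' (k ` U)"
    if U: "U \<subseteq> D" for U
  proof -
    have fU: "finite U" using U D by (rule finite_subset)
    have "{t \<in> T. t \<subseteq> U} = {t \<in> T. t \<subseteq> U \<inter> b ` C} \<union> {t \<in> T. t \<subseteq> U \<and> \<not> t \<subseteq> b ` C}" by auto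
    hence "card {t \<in> T. t \<subseteq> U} =
        card {t \<in> T. t \<subseteq> U \<inter> b ` C} + card {t \<in> T. t \<subseteq> U \<and> \<not> t \<subseteq> b ` C}"
      using fU by (subst card_Un_disjoint[symmetric])
        (auto intro: finite_triples_within finite_subset[of _ "Pow U"])
    moreover have "card U = card (U \<inter> b ` C) + card (U - b ` C)"
      using fU by (metis Int_Diff_Un Int_Diff_disjoint card_Un_disjoint finite_Diff finite_Int)
    ultimately show ?thesis using new[OF U] dim[OF U] by linarith
  qed
  have "strong R' {} (k ` D)"
    unfolding strong_def
  proof (intro conjI allI impI)
    fix U' assume "finite U' \<and> {} \<subseteq> U' \<and> U' \<subseteq> k ` D"
    then obtain U where U: "U \<subseteq> D" "U' = k ` U" by (auto simp: subset_image_iff)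
    define C' where "C' = {c \<in> C. b c \<in> U}"
    have C': "b ` C' = U \<inter> b ` C" "C' \<subseteq> C" by (auto simp: C'_def)
    have "{t \<in> T. t \<subseteq> U \<inter> b ` C} = {t \<in> {t \<in> T. t \<subseteq> b ` C}. t \<subseteq> b ` C'}"
      unfolding C'(1) by auto
    also have "\<dots> = image b ` {t \<in> triples R. t \<subseteq> C'}"
      unfolding old using C'(2) by (auto simp: image_subset_image_iff[OF b(1)])
    finally have "card {t \<in> T. t \<subseteq> U \<inter> b ` C} = r_count R C'"
      unfolding r_count_triples using C'(2)
      by (simp add: card_image inj_on_subset[OF inj_on_image_Pow[OF b(1)]] subset_iff)
    moreover have "card (U \<inter> b ` C) = card C'"
      unfolding C'(1)[symmetric] by (rule card_image[OF inj_on_subset[OF b(1) C'(2)]])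
    moreover have "0 \<le> d0 R C'"
      using C'(2) CM by (intro generic_d0_nonneg[OF gen]) (auto intro: finite_subset)
    ultimately have "0 \<le> d0 R' U'" using bound[OF U(1)] by (simp add: d0_def U(2))
    moreover have "d0 R' {} \<le> 0" by (simp add: d0_def)
    ultimately show "d0 R' {} \<le> d0 R' U'" by simp
  qed auto
  hence cls: "class_C (k ` D) R'" using D rB by (simp add: class_C_def)
  have emb: "embedding C R (k ` D) R' (k \<circ> b)"
    unfolding embedding_def
  proof (intro conjI ballI)
    show "(k \<circ> b) ` C \<subseteq> k ` D" using b(2) by auto
    show "inj_on (k \<circ> b) C" using b k by (auto intro: comp_inj_on inj_on_subset)
    fix x y z assume xyz: "x \<in> C" "y \<in> C" "z \<in> C"
    have "R x y z \<longleftrightarrow> {x, y, z} \<in> {t \<in> triples R. t \<subseteq> C}"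
      using xyz by (simp add: triple_iff[OF rM])
    also have "\<dots> \<longleftrightarrow> b ` {x, y, z} \<in> {t \<in> T. t \<subseteq> b ` C}"
      unfolding old using xyz
      by (intro inj_on_image_mem_iff[OF inj_on_image_Pow[OF b(1)], symmetric]) auto
    also have "\<dots> \<longleftrightarrow> {b x, b y, b z} \<in> T" using xyz by auto
    also have "\<dots> \<longleftrightarrow> k ` {b x, b y, b z} \<in> image k ` T"
      using xyz b(2) by (intro kT[symmetric]) auto
    finally show "R x y z \<longleftrightarrow> R' ((k \<circ> b) x) ((k \<circ> b) y) ((k \<circ> b) z)" by (simp add: R'_def)
  qed
  have str: "strong R' ((k \<circ> b) ` C) (k ` D)"
    unfolding strong_def
  proof (intro conjI allI impI)
    fix U' assume *: "finite U' \<and> (k \<circ> b) ` C \<subseteq> U' \<and> U' \<subseteq> k ` D"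
    then obtain U where U: "U \<subseteq> D" "U' = k ` U" by (auto simp: subset_image_iff)
    have "b ` C \<subseteq> U" using * image_subset_image_iff[OF k b(2) U(1)]
      unfolding U(2) image_comp[symmetric] by blast
    hence "U \<inter> b ` C = b ` C" by auto
    thus "d0 R' ((k \<circ> b) ` C) \<le> d0 R' U'"
      using bound[OF U(1)] dim[OF b(2)] unfolding U(2) image_comp[symmetric] by simp
  qed (use CM b in auto)
  have "\<forall>A (B :: nat set) R' e.
      strong R A M \<and> class_C B R' \<and> embedding A R B R' e \<and> strong R' (e ` A) B \<longrightarrow>
      (\<exists>f. embedding B R' M R f \<and> (\<forall>a\<in>A. f (e a) = a) \<and> strong R (f ` B) M)"
    using gen unfolding hrushovski_generic_def by (elim conjE)
  from this[rule_format, OF conjI[OF C conjI[OF cls conjI[OF emb str]]]]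
  obtain f where f: "embedding (k ` D) R' M R f" "\<And>a. a \<in> C \<Longrightarrow> f ((k \<circ> b) a) = a"
      "strong R (f ` k ` D) M"
    by blast
  have inj: "inj_on f (k ` D)" and fR: "\<And>x y z. x \<in> k ` D \<Longrightarrow> y \<in> k ` D \<Longrightarrow> z \<in> k ` D \<Longrightarrow>
      R' x y z \<longleftrightarrow> R (f x) (f y) (f z)"
    using f(1) by (auto simp: embedding_def)
  have "{t \<in> triples R. t \<subseteq> f ` k ` D} = image f ` image k ` T"
  proof (rule subset_antisym; rule subsetI)
    fix t assume "t \<in> {t \<in> triples R. t \<subseteq> f ` k ` D}"
    then obtain a b c where abc: "t = {a, b, c}" "R a b c" "{a, b, c} \<subseteq> f ` k ` D"
      unfolding triples_def by blast
    hence "a \<in> f ` k ` D" "b \<in> f ` k ` D" "c \<in> f ` k ` D" by simp_all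
    then obtain x y z where "x \<in> k ` D" "a = f x" "y \<in> k ` D" "b = f y" "z \<in> k ` D" "c = f z"
      by (elim imageE[of _ f])
    hence xyz: "t = f ` {x, y, z}" "{x, y, z} \<in> image k ` T"
      using abc(1,2) fR[of x y z] by (simp_all add: R'_def)
    show "t \<in> image f ` image k ` T" unfolding xyz(1) using xyz(2) by (rule imageI)
  next
    fix t assume "t \<in> image f ` image k ` T"
    then obtain s where s: "s \<in> image k ` T" "t = f ` s" by blast
    obtain x y z where xyz: "s = {x, y, z}" using T3[OF s(1)] card_3_iff by metis
    hence "R (f x) (f y) (f z)" using s(1) T3[OF s(1)] fR[of x y z] by (simp add: R'_def)
    hence "t \<in> triples R" unfolding s(2) xyz triples_def by auto
    thus "t \<in> {t \<in> triples R. t \<subseteq> f ` k ` D}" using s(2) T3[OF s(1)] by blast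
  qed
  moreover have "image f ` image k ` T = image (f \<circ> k) ` T" by (simp add: image_image)
  ultimately show ?thesis
    using f inj k by (intro that[of "f \<circ> k"]) (auto simp: embedding_def image_comp intro: comp_inj_on)
qed

section \<open>Free extension by abstract points and lines\<close>

text \<open>
  Elements of the free extension of a strong set: \<open>Base\<close> for the elements of the
  set itself, \<open>New\<close> for new points, and two elements \<open>End y True\<close> and
  \<open>End y False\<close> for a new line \<open>y\<close>. The labels \<open>x\<close> and
  \<open>y\<close> of new points and lines are those of the pattern to be copied, which is also
  a part of \<open>M\<close> and may overlap with the set that is extended; hence the tags.
\<close>

datatype 'a ext = Base 'a | New 'a | End "'a set" bool

definition place :: "('a \<Rightarrow> 'a) \<Rightarrow> 'a set \<Rightarrow> 'a \<Rightarrow> 'a ext" where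
  "place f X x = (if x \<in> X then Base (f x) else New x)"

definition free_line :: "('a set \<Rightarrow> 'a set) \<Rightarrow> 'a set set \<Rightarrow> 'a set \<Rightarrow> 'a ext set" where
  "free_line g Y y = (if y \<in> Y then Base ` g y else {End y True, End y False})"

definition free_points :: "'a set \<Rightarrow> 'a set \<Rightarrow> 'a set set \<Rightarrow> 'a set \<Rightarrow> 'a set set \<Rightarrow> 'a ext set" where
  "free_points C X Y X' Y' = Base ` C \<union> New ` (X' - X) \<union> {End y b | y b. y \<in> Y' - Y}"

lemma inj_Base: "inj Base"
  by (simp add: inj_def)

lemma card_Base: "card (Base ` s) = card s"
  by (simp add: card_image inj_on_def)

text \<open>
  The situation of one step of the back-and-forth argument: \<open>f\<close> and
  \<open>g\<close> form an isomorphism from \<open>(X, Y)\<close> to another strong pair, whose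
  points and lines live in the strong set \<open>C\<close>, and \<open>(X', Y')\<close> is the
  extension of \<open>(X, Y)\<close> that is to be copied over \<open>C\<close>.
\<close>

locale free_extension =
  fixes M :: "'a set" and R :: "'a \<Rightarrow> 'a \<Rightarrow> 'a \<Rightarrow> bool"
    and X X' C :: "'a set" and Y Y' :: "'a set set"
    and f :: "'a \<Rightarrow> 'a" and g :: "'a set \<Rightarrow> 'a set"
  assumes rM: "r_structure M R"
    and source: "lstrong M R X Y" and target: "lstrong M R (f ` X) (g ` Y)"
    and ext: "finite X'" "finite Y'" "X \<subseteq> X'" "Y \<subseteq> Y'" "X' \<subseteq> M" "Y' \<subseteq> lines M"
    and inj_f: "inj_on f X" and inj_g: "inj_on g Y"
    and iso: "\<And>x y. x \<in> X \<Longrightarrow> y \<in> Y \<Longrightarrow>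
      insert (f x) (g y) \<in> triples R \<longleftrightarrow> insert x y \<in> triples R"
    and C: "strong R C M" "f ` X \<subseteq> C" "g ` Y \<subseteq> Pow C"
begin

abbreviation "pt \<equiv> place f X"
abbreviation "ln \<equiv> free_line g Y"
abbreviation "D \<equiv> free_points C X Y X' Y'"
abbreviation "new_flags \<equiv> flags R X' Y' - flags R X Y"

definition new_triples :: "'a ext set set" where
  "new_triples = (\<lambda>(x, y). insert (pt x) (ln y)) ` new_flags"

definition T :: "'a ext set set" where
  "T = image Base ` {t \<in> triples R. t \<subseteq> C} \<union> new_triples"

lemma finite_C: "finite C" "C \<subseteq> M"
  using C(1) by (auto simp: strong_def)

lemma finite_D: "finite D"
proof -
  have "{End y b | y b. y \<in> Y' - Y} = (\<lambda>(y, b). End y b) ` ((Y' - Y) \<times> UNIV)" by auto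
  thus ?thesis using ext finite_C by (simp add: free_points_def)
qed

lemma g_lines: "y \<in> Y \<Longrightarrow> card (g y) = 2" "y \<in> Y \<Longrightarrow> g y \<subseteq> C"
  using target C(3) by (auto simp: lstrong_def lines_def)

lemma pt_in_D: "x \<in> X' \<Longrightarrow> pt x \<in> D"
  using C(2) by (auto simp: place_def free_points_def)

lemma ln_subset_D: "y \<in> Y' \<Longrightarrow> ln y \<subseteq> D"
  using g_lines(2)[of y] by (cases "y \<in> Y") (simp_all add: free_line_def free_points_def, blast+)

lemma card_ln: "card (ln y) = 2" if "y \<in> Y'"
  using g_lines(1)[of y] by (simp add: free_line_def card_Base)

lemma inj_pt: "inj_on pt X'"
  using inj_f by (auto simp: inj_on_def place_def)

lemma inj_ln: "inj_on ln Y'"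
proof (rule inj_onI)
  fix y z assume "y \<in> Y'" "z \<in> Y'" "ln y = ln z"
  thus "y = z"
    using inj_on_eq_iff[OF inj_g]
    by (auto simp: free_line_def inj_image_eq_iff[OF inj_Base] doubleton_eq_iff split: if_splits)
qed

lemma new_flag:
  assumes "(x, y) \<in> new_flags"
  shows "x \<in> X'" "y \<in> Y'" "x \<notin> X \<or> y \<notin> Y" "pt x \<notin> ln y"
  using assms by (auto simp: flags_def place_def free_line_def)

lemma T_card: "t \<in> T \<Longrightarrow> card t = 3 \<and> t \<subseteq> D"
proof -
  assume "t \<in> T"
  then consider s where "s \<in> triples R" "s \<subseteq> C" "t = Base ` s"
    | x y where "(x, y) \<in> new_flags" "t = insert (pt x) (ln y)"
    by (auto simp: T_def new_triples_def)
  thus ?thesis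
  proof cases
    case 1
    thus ?thesis using triples_card(1)[OF rM] by (auto simp: card_Base free_points_def)
  next
    case 2
    note * = new_flag[OF 2(1)]
    have "finite (ln y)" using card_ln[OF *(2)] by (simp add: card_ge_0_finite)
    thus ?thesis using * card_ln[OF *(2)] pt_in_D ln_subset_D by (auto simp: 2(2))
  qed
qed

lemma new_triple_not_old: "t \<in> new_triples \<Longrightarrow> \<not> t \<subseteq> Base ` C"
  using new_flag(3) by (auto simp: new_triples_def place_def free_line_def split: if_splits)

lemma old_triples: "{t \<in> T. t \<subseteq> Base ` C} = image Base ` {t \<in> triples R. t \<subseteq> C}"
  using new_triple_not_old by (auto simp: T_def)

text \<open>
  The free extension is strong over \<open>C\<close>. A new triple inside \<open>U\<close>
  encodes a new incidence, and only those new lines count that have both ends in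
  \<open>U\<close>. So the bound is strongness of \<open>(X, Y)\<close>, applied to the
  extension by the points and the complete lines that \<open>U\<close> contains.
\<close>

lemma card_new_triples_le:
  assumes "U \<subseteq> D"
  shows "card {t \<in> T. t \<subseteq> U \<and> \<not> t \<subseteq> Base ` C} \<le> card (U - Base ` C)"
proof -
  define P where "P = {p \<in> X' - X. New p \<in> U}"
  define Q where "Q = {q \<in> Y' - Y. End q True \<in> U \<and> End q False \<in> U}"
  let ?F = "flags R (X \<union> P) (Y \<union> Q)"
  have fin: "finite X" "finite Y" "finite P" "finite Q" "finite U"
    using ext finite_D assms by (auto simp: P_def Q_def intro: finite_subset)
  have "{t \<in> T. t \<subseteq> U \<and> \<not> t \<subseteq> Base ` C} \<subseteq> (\<lambda>(x, y). insert (pt x) (ln y)) ` (?F - flags R X Y)"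
  proof
    fix t assume "t \<in> {t \<in> T. t \<subseteq> U \<and> \<not> t \<subseteq> Base ` C}"
    then obtain x y where t: "(x, y) \<in> new_flags" "t = insert (pt x) (ln y)" "t \<subseteq> U"
      by (auto simp: T_def new_triples_def)
    have "x \<in> X \<union> P" using t by (auto simp: P_def flags_def place_def)
    moreover have "y \<in> Y \<union> Q" using t by (auto simp: Q_def flags_def free_line_def)
    ultimately have "(x, y) \<in> ?F - flags R X Y" using t(1) by (auto simp: flags_def)
    thus "t \<in> (\<lambda>(x, y). insert (pt x) (ln y)) ` (?F - flags R X Y)" by (auto simp: t(2))
  qed
  hence "card {t \<in> T. t \<subseteq> U \<and> \<not> t \<subseteq> Base ` C} \<le> card (?F - flags R X Y)"
    using fin by (intro surj_card_le) (auto intro: finite_flags)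
  also have "\<dots> = card ?F - card (flags R X Y)"
    using fin by (intro card_Diff_subset finite_flags) (auto simp: flags_def)
  also have "\<dots> \<le> card P + 2 * card Q"
  proof -
    have "ldim R X Y \<le> ldim R (X \<union> P) (Y \<union> Q)"
      using ext fin by (intro lstrong_le[OF source]) (auto simp: P_def Q_def)
    moreover have "card (X \<union> P) = card X + card P" "card (Y \<union> Q) = card Y + card Q"
      using fin by (auto intro!: card_Un_disjoint simp: P_def Q_def)
    ultimately show ?thesis unfolding ldim_def by linarith
  qed
  also have "\<dots> = card (New ` P) + card ((\<lambda>q. End q True) ` Q) + card ((\<lambda>q. End q False) ` Q)"
    by (simp add: card_image inj_on_def)
  also have "\<dots> = card (New ` P \<union> (\<lambda>q. End q True) ` Q \<union> (\<lambda>q. End q False) ` Q)"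
    using fin by (subst card_Un_disjoint; (subst card_Un_disjoint)?) auto
  also have "\<dots> \<le> card (U - Base ` C)"
    using fin by (intro card_mono) (auto simp: P_def Q_def)
  finally show ?thesis .
qed

text \<open>
  A second incidence with \<open>Y\<close> would make adding the point \<open>p\<close> decrease
  the predimension. This is what controls the accidental lines \<open>{p, b}\<close> with
  \<open>b\<close> in \<open>C\<close>: without it such a line could carry many points.
\<close>

lemma at_most_one_old_line:
  assumes "p \<in> X' - X" "y \<in> Y" "z \<in> Y" "insert p y \<in> triples R" "insert p z \<in> triples R"
  shows "y = z"
proof (rule ccontr)
  assume "y \<noteq> z"
  have fin: "finite X" "finite Y" using source by (auto simp: lstrong_def)
  have "card (flags R X Y \<union> {(p, y), (p, z)}) \<le> card (flags R (insert p X) Y)"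
    using assms fin by (intro card_mono finite_flags) (auto simp: flags_def)
  moreover have "card (flags R X Y \<union> {(p, y), (p, z)}) = card (flags R X Y) + 2"
    using assms(1) \<open>y \<noteq> z\<close> fin
    by (subst card_Un_disjoint[OF finite_flags]) (auto simp: flags_def)
  moreover have "ldim R X Y \<le> ldim R (insert p X) Y"
    using source assms(1) ext by (intro lstrong_le[OF source]) (auto simp: lstrong_def)
  moreover have "card (insert p X) = card X + 1" using fin assms(1) by simp
  ultimately show False unfolding ldim_def by linarith
qed

lemma End_in_new_triple:
  assumes "(x, y) \<in> new_flags" "End q b \<in> insert (pt x) (ln y)"
  shows "y = q" "q \<notin> Y" "ln y = {End q b, End q (\<not> b)}"
  using assms(2) by (cases b; auto simp: place_def free_line_def split: if_splits)+

lemma New_in_new_triple: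
  assumes "(x, y) \<in> new_flags" "New p \<in> insert (pt x) (ln y)"
  shows "x = p" "p \<notin> X" "p \<in> X'"
  using assms by (auto simp: place_def free_line_def flags_def split: if_splits)

lemma new_triple_inject:
  assumes "(x, y) \<in> new_flags" "x' \<in> X'" "y' \<in> Y'" "x' \<notin> X \<or> y' \<notin> Y"
    and eq: "insert (pt x) (ln y) = insert (pt x') (ln y')"
  shows "x = x' \<and> y = y'"
proof (cases "y' \<in> Y")
  case False
  hence "End y' True \<in> insert (pt x) (ln y)" unfolding eq by (simp add: free_line_def)
  hence y: "y = y'" using End_in_new_triple(1)[OF assms(1)] by blast
  have "pt x' \<notin> ln y'" using False by (simp add: place_def free_line_def)
  hence "pt x = pt x'" using eq new_flag(4)[OF assms(1)] unfolding y by blast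
  thus ?thesis using y inj_pt new_flag(1)[OF assms(1)] assms(2) by (auto dest: inj_onD)
next
  case True
  hence x': "x' \<notin> X" using assms(4) by blast
  hence "New x' \<in> insert (pt x) (ln y)" unfolding eq by (simp add: place_def)
  hence x: "x = x'" using New_in_new_triple(1)[OF assms(1)] by blast
  have "pt x' \<notin> ln y'" using True x' by (auto simp: place_def free_line_def)
  hence "ln y = ln y'" using eq new_flag(4)[OF assms(1)] unfolding x by (metis insert_ident)
  thus ?thesis using x inj_ln new_flag(2)[OF assms(1)] assms(3) by (auto dest: inj_onD)
qed

text \<open>
  The free extension realizes the pattern \<open>(X', Y')\<close> exactly: thanks to the tags, a
  new triple can be read back uniquely as an incidence, so no incidence is created between
  points and lines of the pattern that are not incident already.
\<close>

lemma T_iff_flag: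
  assumes "x \<in> X'" "y \<in> Y'"
  shows "insert (pt x) (ln y) \<in> T \<longleftrightarrow> insert x y \<in> triples R"
proof (cases "x \<in> X \<and> y \<in> Y")
  case True
  have eq: "insert (pt x) (ln y) = Base ` insert (f x) (g y)"
    using True by (simp add: place_def free_line_def)
  have sub: "insert (f x) (g y) \<subseteq> C" using True C by auto
  have "insert (pt x) (ln y) \<in> T \<longleftrightarrow> insert (pt x) (ln y) \<in> {t \<in> T. t \<subseteq> Base ` C}"
    using sub unfolding eq by blast
  also have "\<dots> \<longleftrightarrow> insert (f x) (g y) \<in> {t \<in> triples R. t \<subseteq> C}"
    unfolding old_triples eq by (intro inj_image_mem_iff) (auto simp: inj_image_eq_iff[OF inj_Base] intro!: injI)
  finally show ?thesis using sub iso True by simp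
next
  case False
  have "insert (pt x) (ln y) \<in> T \<longleftrightarrow> insert (pt x) (ln y) \<in> new_triples"
    using False by (auto simp: T_def place_def free_line_def)
  also have "\<dots> \<longleftrightarrow> (x, y) \<in> new_flags"
  proof
    assume "insert (pt x) (ln y) \<in> new_triples"
    then obtain x' y' where *: "(x', y') \<in> new_flags" "insert (pt x') (ln y') = insert (pt x) (ln y)"
      by (auto simp: new_triples_def)
    have "x' = x \<and> y' = y" using False by (intro new_triple_inject[OF *(1) assms _ *(2)]) auto
    thus "(x, y) \<in> new_flags" using *(1) by blast
  qed (force simp: new_triples_def)
  also have "\<dots> \<longleftrightarrow> insert x y \<in> triples R" using False assms by (auto simp: flags_def)
  finally show ?thesis .
qed

lemma T_not_old_cases:
  assumes "t \<in> T" "\<not> t \<subseteq> Base ` C"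
  obtains x y where "(x, y) \<in> new_flags" "t = insert (pt x) (ln y)"
  using assms by (auto simp: T_def new_triples_def)

lemma new_point_on_old_line:
  assumes "x \<notin> Base ` C" "y \<subseteq> Base ` C" "insert x y \<in> T" "card y = 2"
  obtains p z where "p \<in> X'" "z \<in> Y" "x = pt p" "y = ln z"
proof -
  obtain p z where pz: "(p, z) \<in> new_flags" "insert x y = insert (pt p) (ln z)"
    by (rule T_not_old_cases[OF assms(3)]) (use assms(1) in auto)
  note * = new_flag[OF pz(1)]
  have z: "z \<in> Y"
  proof (rule ccontr)
    assume "z \<notin> Y"
    hence "{End z True, End z False} \<subseteq> insert x y" unfolding pz(2) by (simp add: free_line_def)
    thus False using assms(2) by auto
  qed
  hence p: "p \<notin> X" using * by blast
  hence "New p \<in> insert x y" unfolding pz(2) by (simp add: place_def)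
  hence x: "x = pt p" using assms(2) p by (auto simp: place_def)
  moreover have "pt p \<notin> y" using x assms(1,2) by blast
  ultimately have "y = ln z" using pz(2) *(4) by (metis insert_ident)
  thus ?thesis using that * z x by blast
qed

lemma point_on_new_line:
  assumes "z \<in> Y' - Y" "insert x (ln z) \<in> T" "x \<notin> ln z"
  shows "x \<in> pt ` X'"
proof -
  have E: "End z True \<in> ln z" using assms(1) by (simp add: free_line_def)
  obtain p y where pz: "(p, y) \<in> new_flags" "insert x (ln z) = insert (pt p) (ln y)"
    by (rule T_not_old_cases[OF assms(2)]) (use E in auto)
  have "y = z" using End_in_new_triple(1)[OF pz(1), of z True] E unfolding pz(2)[symmetric] by blast
  hence "x = pt p" using pz(2) assms(3) new_flag(4)[OF pz(1)] by blast
  thus ?thesis using new_flag(1)[OF pz(1)] by blast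
qed

text \<open>
  Besides the intended lines, the free extension has many further pairs of elements that are
  lines of the incidence structure. If such a pair contains an end of a new line
  \<open>q\<close>, only the other end of \<open>q\<close> can be incident with it. Otherwise it
  contains a new point \<open>r\<close>, and then the only triple that can contain the pair is
  the one that puts \<open>r\<close> on its unique old line.
\<close>

lemma stray_line_at_most_one_point:
  assumes y: "y \<subseteq> D" "card y = 2" "\<not> y \<subseteq> Base ` C" "y \<notin> ln ` (Y' - Y)"
    and x: "insert x y \<in> T" and x': "insert x' y \<in> T"
  shows "x = x'"
proof -
  have fy: "finite y" using y(2) by (simp add: card_ge_0_finite)
  have notin: "x \<notin> y" "x' \<notin> y"
    using T_card[OF x] T_card[OF x'] y(2) by (auto simp: insert_absorb)
  obtain p z where pz: "(p, z) \<in> new_flags" "insert x y = insert (pt p) (ln z)"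
    by (rule T_not_old_cases[OF x]) (use y(3) in auto)
  obtain p' z' where pz': "(p', z') \<in> new_flags" "insert x' y = insert (pt p') (ln z')"
    by (rule T_not_old_cases[OF x']) (use y(3) in auto)
  show ?thesis
  proof (cases "\<exists>q b. End q b \<in> y")
    case True
    then obtain q b where q: "End q b \<in> y" by blast
    have other: "u = End q (\<not> b)"
      if u: "(r, w) \<in> new_flags" "insert u y = insert (pt r) (ln w)" "u \<notin> y" for u r w
    proof -
      have w: "w = q" "q \<notin> Y" "ln w = {End q b, End q (\<not> b)}"
        using End_in_new_triple[OF u(1), of q b] q unfolding u(2)[symmetric] by blast+
      have "w \<in> Y'" using new_flag(2)[OF u(1)] .
      hence "ln w \<in> ln ` (Y' - Y)" using w(1,2) by simp
      hence "y \<noteq> ln w" using y(4) by metis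
      moreover have "y = ln w" if "End q (\<not> b) \<in> y"
      proof -
        have "ln w \<subseteq> y" using that q by (simp add: w(3))
        thus ?thesis using card_subset_eq[OF fy, of "ln w"] card_ln[OF \<open>w \<in> Y'\<close>] y(2) by auto
      qed
      ultimately have "End q (\<not> b) \<notin> y" by blast
      moreover have "End q (\<not> b) \<in> insert u y" unfolding u(2) w(3) by simp
      ultimately show ?thesis by simp
    qed
    show ?thesis using other[OF pz notin(1)] other[OF pz' notin(2)] by simp
  next
    case False
    obtain u where u: "u \<in> y" "u \<notin> Base ` C" using y(3) by blast
    hence "u \<in> D" "\<nexists>q b. u = End q b" using y(1) False by blast+
    then obtain r where r: "New r \<in> y" using u by (auto simp: free_points_def)
    have old: "w \<in> Y"
      if u: "(s, w) \<in> new_flags" "insert u y = insert (pt s) (ln w)" for u s w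
    proof (rule ccontr)
      assume "w \<notin> Y"
      hence "{End w True, End w False} \<subseteq> insert u y" unfolding u(2) by (simp add: free_line_def)
      thus False using False by auto
    qed
    have "p = r" "p' = r" "r \<notin> X" "r \<in> X'"
      using New_in_new_triple[OF pz(1), of r] New_in_new_triple[OF pz'(1), of r] r
      unfolding pz(2)[symmetric] pz'(2)[symmetric] by blast+
    note r = this
    have "insert r z \<in> triples R" "insert r z' \<in> triples R"
      using pz(1) pz'(1) r(1,2) by (auto simp: flags_def)
    hence "z = z'"
      using at_most_one_old_line[of r z z'] old[OF pz] old[OF pz'] r(3,4) by simp
    hence "insert x y = insert x' y" using pz(2) pz'(2) r(1,2) by simp
    thus ?thesis using notin by blast
  qed
qed

text \<open>
  By \<open>ldim_restrict_strong\<close> it is enough to compare with pairs \<open>(X2,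
  Y2)\<close> inside the copy of the free extension. There the incidences are of three kinds:
  those inside \<open>C\<close>, which are controlled by strongness of the pair in
  \<open>C\<close>; those intended, which are counted in the predimension of the copy; and those
  on stray lines, at most one for each line and thus outweighed by its weight \<open>2\<close>.
\<close>

lemma lstrong_realization:
  assumes h: "inj_on h D" and hC: "\<And>c. c \<in> C \<Longrightarrow> h (Base c) = c" and hM: "strong R (h ` D) M"
    and hT: "{t \<in> triples R. t \<subseteq> h ` D} = image h ` T"
  defines "F \<equiv> \<lambda>x. h (pt x)" and "G \<equiv> \<lambda>y. h ` ln y"
  shows "lstrong M R (F ` X') (G ` Y')"
proof -
  have DM: "h ` D \<subseteq> M" using hM by (simp add: strong_def)
  have hT_iff: "h ` s \<in> triples R \<longleftrightarrow> s \<in> T" if "s \<subseteq> D" for s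
  proof -
    have "h ` s \<in> triples R \<longleftrightarrow> h ` s \<in> image h ` T" unfolding hT[symmetric] using that by blast
    also have "\<dots> \<longleftrightarrow> s \<in> T"
      using that T_card by (intro inj_on_image_mem_iff[OF inj_on_image_Pow[OF h]]) auto
    finally show ?thesis .
  qed
  have hBase: "h ` Base ` A = A" if "A \<subseteq> C" for A
    using that hC by (auto simp: image_image subset_iff image_iff)
  have hBase_iff: "h ` A \<subseteq> C \<longleftrightarrow> A \<subseteq> Base ` C" if "A \<subseteq> D" for A
    using image_subset_image_iff[OF h that, of "Base ` C"] hBase[of C]
    by (auto simp: free_points_def)
  have FX: "F ` X = f ` X" using C(2) hC by (intro image_cong) (auto simp: F_def place_def)
  have GY: "G ` Y = g ` Y"
  proof (rule image_cong)
    fix y assume y: "y \<in> Y"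
    hence "g y \<subseteq> C" using C(3) by blast
    thus "G y = g y" using y hBase[of "g y"] by (simp add: G_def free_line_def)
  qed simp
  have F_new: "F x \<notin> C" if "x \<in> X' - X" for x
    using hBase_iff[of "{pt x}"] pt_in_D[of x] that by (auto simp: F_def place_def)
  have G_new: "\<not> G y \<subseteq> C" if "y \<in> Y' - Y" for y
    using hBase_iff[of "ln y"] ln_subset_D[of y] that by (auto simp: G_def free_line_def)
  have FM: "F ` X' \<subseteq> M" using pt_in_D DM by (auto simp: F_def)
  have GM: "G ` Y' \<subseteq> lines M"
  proof
    fix z assume "z \<in> G ` Y'"
    then obtain y where y: "y \<in> Y'" "z = h ` ln y" by (auto simp: G_def)
    have "card (h ` ln y) = card (ln y)"
      by (rule card_image[OF inj_on_subset[OF h ln_subset_D[OF y(1)]]])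
    thus "z \<in> lines M" using y ln_subset_D[OF y(1)] card_ln[OF y(1)] DM by (auto simp: lines_def)
  qed
  \<comment> \<open>The intended new incidences; \<open>K1\<close> and \<open>K2\<close> say that incidences with lines of \<open>C\<close> or with copies of
    new lines are either inside \<open>C\<close> or intended.\<close>
  let ?K = "flags R (F ` X') (G ` Y') - flags R (f ` X) (g ` Y)"
  have K1: "(x, y) \<in> ?K"
    if xy: "x \<in> h ` D" "x \<notin> C" "y \<subseteq> C" "card y = 2" "insert x y \<in> triples R" for x y
  proof -
    obtain d where d: "d \<in> D" "x = h d" using xy(1) by blast
    have "insert d (Base ` y) \<subseteq> D" using d(1) xy(3) by (auto simp: free_points_def)
    hence "insert d (Base ` y) \<in> T" using hT_iff[of "insert d (Base ` y)"] xy d hBase by simp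
    moreover have "d \<notin> Base ` C" using xy(2) d(2) hC by auto
    moreover have "Base ` y \<subseteq> Base ` C" using xy(3) by blast
    ultimately obtain p z where pz: "p \<in> X'" "z \<in> Y" "d = pt p" "Base ` y = ln z"
      using new_point_on_old_line[of d "Base ` y"] card_Base[of y] xy(4) by metis
    have "x = F p" "y = G z" using pz d hBase[OF xy(3)] by (simp_all add: F_def G_def flip: pz(4))
    thus ?thesis using pz(1,2) ext(4) xy(2,5) C(2) by (auto simp: flags_def)
  qed
  have K2: "(x, y) \<in> ?K" if xy: "x \<in> h ` D" "y \<in> G ` (Y' - Y)" "insert x y \<in> triples R" for x y
  proof -
    obtain d where d: "d \<in> D" "x = h d" using xy(1) by blast
    obtain z where z: "z \<in> Y' - Y" "y = h ` ln z" using xy(2) by (auto simp: G_def)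
    have "insert d (ln z) \<subseteq> D" using d(1) z(1) ln_subset_D by blast
    hence "insert d (ln z) \<in> T" using hT_iff[of "insert d (ln z)"] xy(3) d z by simp
    moreover have "d \<notin> ln z"
      using flag_point_notin_line[OF rM _ xy(3)] xy(2) GM d z by (auto simp: lines_def)
    ultimately have "d \<in> pt ` X'" using point_on_new_line[OF z(1)] by blast
    hence "x \<in> F ` X'" using d by (auto simp: F_def)
    moreover have "y \<notin> g ` Y" using xy(2) G_new C(3) by blast
    ultimately show ?thesis using xy(2,3) by (auto simp: flags_def)
  qed
  have stray: "x = x'"
    if xy: "x \<in> h ` D" "x' \<in> h ` D" "y \<subseteq> h ` D" "card y = 2" "\<not> y \<subseteq> C" "y \<notin> G ` (Y' - Y)"
      "insert x y \<in> triples R" "insert x' y \<in> triples R" for x x' y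
  proof -
    obtain d d' where d: "d \<in> D" "x = h d" "d' \<in> D" "x' = h d'" using xy(1,2) by blast
    obtain z where z: "z \<subseteq> D" "y = h ` z" using xy(3) by (auto simp: subset_image_iff)
    have "card z = 2" using xy(4) card_image[OF inj_on_subset[OF h z(1)]] z(2) by simp
    moreover have "\<not> z \<subseteq> Base ` C" using hBase_iff[OF z(1)] xy(5) z(2) by simp
    moreover have "z \<notin> ln ` (Y' - Y)" using xy(6) z(2) by (auto simp: G_def)
    moreover have "insert d z \<in> T" "insert d' z \<in> T"
      using hT_iff[of "insert d z"] hT_iff[of "insert d' z"] xy(7,8) d z by simp_all
    ultimately show ?thesis using stray_line_at_most_one_point[OF z(1)] d by blast
  qed
  have finX: "finite X" "finite Y" using source by (auto simp: lstrong_def)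
  have min: "ldim R (F ` X') (G ` Y') \<le> ldim R X2 Y2"
    if fin: "finite X2" "finite Y2" and sup: "F ` X' \<subseteq> X2" "G ` Y' \<subseteq> Y2"
      and inD: "X2 \<subseteq> h ` D" "Y2 \<subseteq> lines M \<inter> Pow (h ` D)" for X2 Y2
  proof -
    let ?X0 = "X2 \<inter> C" and ?Y0 = "Y2 \<inter> Pow C"
    let ?Q = "G ` (Y' - Y)" and ?P = "F ` (X' - X)"
    \<comment> \<open>The stray lines, which are neither inside \<open>C\<close> nor copies of lines of the pattern.\<close>
    let ?Z = "Y2 - Pow C - ?Q"
    let ?S = "{(x, y) \<in> flags R X2 Y2. y \<in> ?Z}"
    have card2: "card y = 2" if "y \<in> Y2" for y using that inD(2) by (auto simp: lines_def)
    have "flags R X2 Y2 \<subseteq> flags R ?X0 ?Y0 \<union> ?K \<union> ?S"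
    proof (rule subsetI, rule ccontr)
      fix p assume p: "p \<in> flags R X2 Y2" "p \<notin> flags R ?X0 ?Y0 \<union> ?K \<union> ?S"
      obtain x y where xy: "p = (x, y)" by fastforce
      have notin: "(x, y) \<notin> flags R ?X0 ?Y0" "(x, y) \<notin> ?K" "(x, y) \<notin> ?S"
        using p(2) unfolding xy by blast+
      have *: "x \<in> X2" "y \<in> Y2" "insert x y \<in> triples R" "x \<in> h ` D"
        using p(1) inD(1) by (auto simp: xy flags_def)
      have "y \<notin> ?Q" using K2[OF *(4) _ *(3)] notin(2) by blast
      moreover have "y \<notin> ?Z" using notin(3) p(1) unfolding xy by blast
      ultimately have y: "y \<subseteq> C" using *(2) by blast
      have "x \<in> C" using K1[OF *(4) _ y card2[OF *(2)] *(3)] notin(2) by blast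
      thus False using * y notin(1) by (auto simp: flags_def)
    qed
    moreover have fK: "finite ?K" using ext by (intro finite_Diff finite_flags) auto
    moreover have fS: "finite ?S" using fin by (auto intro: finite_subset[OF _ finite_flags])
    ultimately have "card (flags R X2 Y2) \<le> card (flags R ?X0 ?Y0 \<union> ?K \<union> ?S)"
      using fin by (intro card_mono) (auto intro: finite_flags)
    also have "\<dots> \<le> card (flags R ?X0 ?Y0) + card ?K + card ?S"
      by (meson add_le_mono1 card_Un_le order_trans)
    finally have le: "card (flags R X2 Y2) \<le> card (flags R ?X0 ?Y0) + card ?K + card ?S" .
    have "inj_on snd ?S"
    proof (rule inj_onI)
      fix p q assume pq: "p \<in> ?S" "q \<in> ?S" "snd p = snd q"
      obtain x y x' where xy: "p = (x, y)" "q = (x', y)" using pq(3) by (metis prod.collapse)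
      have *: "x \<in> X2" "x' \<in> X2" "y \<in> Y2" "y \<notin> Pow C" "y \<notin> ?Q"
          "insert x y \<in> triples R" "insert x' y \<in> triples R"
        using pq(1,2) unfolding xy flags_def by blast+
      have "x = x'"
        by (rule stray[OF _ _ _ card2[OF *(3)] _ *(5,6,7)]) (use * inD in auto)
      thus "p = q" by (simp add: xy)
    qed
    hence S: "card ?S \<le> card ?Z" using fin(2) by (intro card_inj_on_le[of snd]) auto
    have subK: "flags R (f ` X) (g ` Y) \<subseteq> flags R (F ` X') (G ` Y')"
      unfolding FX[symmetric] GY[symmetric] using ext by (auto simp: flags_def)
    have K: "card ?K = card (flags R (F ` X') (G ` Y')) - card (flags R (f ` X) (g ` Y))"
      using finX by (intro card_Diff_subset finite_flags subK) auto
    have K': "card (flags R (f ` X) (g ` Y)) \<le> card (flags R (F ` X') (G ` Y'))"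
      using ext by (intro card_mono finite_flags subK) auto
    have "F ` X \<subseteq> X2" "G ` Y \<subseteq> Y2" using sup ext(3,4) by blast+
    hence sub0: "f ` X \<subseteq> ?X0" "g ` Y \<subseteq> ?Y0" using C(2,3) unfolding FX GY by blast+
    have old: "ldim R (f ` X) (g ` Y) \<le> ldim R ?X0 ?Y0"
      using fin inD finite_C by (intro lstrong_le[OF target _ _ sub0]) auto
    have cX2: "card ?X0 + card ?P \<le> card X2"
    proof -
      have "card ?X0 + card ?P = card (?X0 \<union> ?P)"
        using fin ext F_new by (intro card_Un_disjoint[symmetric]) auto
      also have "\<dots> \<le> card X2" using sup(1) fin(1) by (intro card_mono) auto
      finally show ?thesis .
    qed
    have cY2: "card Y2 = card ?Y0 + card ?Q + card ?Z"
    proof -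
      have "Y2 = (?Y0 \<union> ?Q) \<union> ?Z" using sup(2) by blast
      hence "card Y2 = card (?Y0 \<union> ?Q) + card ?Z"
        using fin(2) ext(2) by (subst card_Un_disjoint[symmetric]) (auto simp only: finite_Un finite_Int finite_imageI finite_Diff)
      also have "card (?Y0 \<union> ?Q) = card ?Y0 + card ?Q"
        using fin ext G_new by (intro card_Un_disjoint) auto
      finally show ?thesis .
    qed
    have cF: "card (F ` X') = card (f ` X) + card ?P"
    proof -
      have "F ` X' = f ` X \<union> ?P" using ext(3) unfolding FX[symmetric] by blast
      thus ?thesis using finX ext C(2) F_new by (simp, intro card_Un_disjoint) auto
    qed
    have cG: "card (G ` Y') = card (g ` Y) + card ?Q"
    proof -
      have "G ` Y' = g ` Y \<union> ?Q" using ext(4) unfolding GY[symmetric] by blast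
      thus ?thesis using finX ext C(3) G_new by (simp, intro card_Un_disjoint) auto
    qed
    show ?thesis
      using le S K K' old cX2 cY2 cF cG unfolding ldim_def by linarith
  qed
  have "ldim R (F ` X') (G ` Y') \<le> ldim R X2 Y2"
    if XY: "finite X2 \<and> finite Y2 \<and> F ` X' \<subseteq> X2 \<and> G ` Y' \<subseteq> Y2 \<and> X2 \<subseteq> M \<and> Y2 \<subseteq> lines M" for X2 Y2
  proof -
    have "ldim R (F ` X') (G ` Y') \<le> ldim R (X2 \<inter> h ` D) (Y2 \<inter> Pow (h ` D))"
    proof (rule min)
      show "F ` X' \<subseteq> X2 \<inter> h ` D" using XY pt_in_D by (auto simp: F_def)
      show "G ` Y' \<subseteq> Y2 \<inter> Pow (h ` D)" using XY ln_subset_D by (auto simp: G_def)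
    qed (use XY in auto)
    also have "\<dots> \<le> ldim R X2 Y2" using XY by (intro ldim_restrict_strong[OF rM hM]) auto
    finally show ?thesis .
  qed
  thus ?thesis using ext FM GM by (auto simp: lstrong_def)
qed

end

section \<open>Back and forth between strong incidence structures\<close>

definition partial_iso ::
  "'a set \<Rightarrow> ('a \<Rightarrow> 'a \<Rightarrow> 'a \<Rightarrow> bool) \<Rightarrow> 'a set \<Rightarrow> 'a set set \<Rightarrow>
   ('a \<Rightarrow> 'a) \<Rightarrow> ('a set \<Rightarrow> 'a set) \<Rightarrow> bool" where
  "partial_iso M R X Y f g \<longleftrightarrow>
     lstrong M R X Y \<and> lstrong M R (f ` X) (g ` Y) \<and> inj_on f X \<and> inj_on g Y \<and>
     (\<forall>x\<in>X. \<forall>y\<in>Y. insert (f x) (g y) \<in> triples R \<longleftrightarrow> insert x y \<in> triples R)"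

text \<open>
  Because of this symmetry only the forth direction has to be proved.
\<close>

lemma partial_iso_inverse:
  assumes "partial_iso M R X Y f g"
  shows "partial_iso M R (f ` X) (g ` Y) (inv_into X f) (inv_into Y g)"
  using assms unfolding partial_iso_def
  by (simp add: inj_on_inv_into inv_into_image_cancel)

lemma generic_strong_empty:
  assumes "hrushovski_generic M R"
  shows "strong R {} M"
proof -
  have "d0 R {} \<le> d0 R B" if "finite B" "B \<subseteq> M" for B
    using generic_d0_nonneg[OF assms that] by (simp add: d0_def)
  thus ?thesis by (auto simp: strong_def)
qed

lemma generic_ldim_nonneg:
  assumes "hrushovski_generic M R" "finite X" "finite Y" "X \<subseteq> M" "Y \<subseteq> lines M"
  shows "0 \<le> ldim R X Y"
proof -
  have "Y \<inter> Pow {} = {}" using assms(5) by (auto simp: lines_def)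
  hence "ldim R (X \<inter> {}) (Y \<inter> Pow {}) = 0" by (simp add: ldim_def flags_def)
  thus ?thesis
    using ldim_restrict_strong[OF generic_r_structure generic_strong_empty] assms by metis
qed

text \<open>
  A finite superset of least predimension is strong; the minimum exists because the predimension
  is an integer bounded below by \<open>0\<close>.
\<close>

lemma strong_superset_exists:
  assumes gen: "hrushovski_generic M R" and "finite A" "A \<subseteq> M"
  obtains C where "A \<subseteq> C" "strong R C M"
proof -
  let ?P = "\<lambda>C. finite C \<and> A \<subseteq> C \<and> C \<subseteq> M"
  have "?P A" using assms by simp
  then obtain C where C: "?P C" "\<And>B. ?P B \<Longrightarrow> nat (d0 R C) \<le> nat (d0 R B)"
    using ex_has_least_nat[of ?P A "\<lambda>C. nat (d0 R C)"] by blast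
  have "d0 R C \<le> d0 R B" if B: "finite B" "C \<subseteq> B" "B \<subseteq> M" for B
  proof -
    have "?P B" using B C(1) by blast
    thus ?thesis using C(2)[of B] generic_d0_nonneg[OF gen B(1,3)] by linarith
  qed
  thus ?thesis using that[of C] C(1) by (auto simp: strong_def)
qed

lemma lstrong_superset_exists:
  assumes gen: "hrushovski_generic M R"
    and "finite X" "finite Y" "X \<subseteq> M" "Y \<subseteq> lines M"
  obtains X' Y' where "X \<subseteq> X'" "Y \<subseteq> Y'" "lstrong M R X' Y'"
proof -
  let ?P = "\<lambda>(X', Y'). finite X' \<and> finite Y' \<and> X \<subseteq> X' \<and> Y \<subseteq> Y' \<and> X' \<subseteq> M \<and> Y' \<subseteq> lines M"
  let ?m = "\<lambda>(X', Y'). nat (ldim R X' Y')"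
  have "?P (X, Y)" using assms by simp
  from ex_has_least_nat[of ?P _ ?m, OF this]
  obtain Z where least: "?P Z \<and> (\<forall>W. ?P W \<longrightarrow> ?m Z \<le> ?m W)" by (rule exE)
  then obtain X' Y' where Z: "Z = (X', Y')" "?P (X', Y')" by (cases Z) auto
  have "ldim R X' Y' \<le> ldim R A B"
    if AB: "finite A" "finite B" "X' \<subseteq> A" "Y' \<subseteq> B" "A \<subseteq> M" "B \<subseteq> lines M" for A B
  proof -
    have "?P (A, B)" using AB Z(2) by auto
    thus ?thesis
      using least[THEN conjunct2, rule_format, of "(A, B)"] generic_ldim_nonneg[OF gen AB(1,2,5,6)] unfolding Z(1) by simp
  qed
  thus ?thesis using that[of X' Y'] Z(2) by (simp add: lstrong_def)
qed

text \<open>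
  The forth step when both sides are given: copy the pattern freely over \<open>C\<close> and
  embed the result in \<open>M\<close> by genericity.
\<close>

lemma (in free_extension) realization_exists:
  assumes gen: "hrushovski_generic M R" and X'Y': "lstrong M R X' Y'"
  obtains F G where "partial_iso M R X' Y' F G" "\<And>x. x \<in> X \<Longrightarrow> F x = f x"
proof -
  have base: "inj_on Base C" "Base ` C \<subseteq> D" by (auto simp: free_points_def inj_on_def)
  obtain h where h: "inj_on h D" "\<And>c. c \<in> C \<Longrightarrow> h (Base c) = c" "h ` D \<subseteq> M"
      "{t \<in> triples R. t \<subseteq> h ` D} = image h ` T" "strong R (h ` D) M"
    using generic_extension[OF gen C(1) finite_D T_card base old_triples card_new_triples_le]
    by blast
  let ?F = "\<lambda>x. h (pt x)" and ?G = "\<lambda>y. h ` ln y"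
  have "inj_on ?F X'"
    using comp_inj_on[OF inj_pt inj_on_subset[OF h(1), of "pt ` X'"]] pt_in_D
    by (auto simp: comp_def)
  moreover have "inj_on ?G Y'"
    using comp_inj_on[OF inj_ln inj_on_subset[OF inj_on_image_Pow[OF h(1)], of "ln ` Y'"]] ln_subset_D
    by (auto simp: comp_def)
  moreover have "insert (?F x) (?G y) \<in> triples R \<longleftrightarrow> insert x y \<in> triples R"
    if xy: "x \<in> X'" "y \<in> Y'" for x y
  proof -
    let ?t = "insert (pt x) (ln y)"
    have t: "?t \<subseteq> D" using pt_in_D[OF xy(1)] ln_subset_D[OF xy(2)] by simp
    have "insert (?F x) (?G y) \<in> triples R \<longleftrightarrow> h ` ?t \<in> image h ` T"
      unfolding h(4)[symmetric] using t by auto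
    also have "\<dots> \<longleftrightarrow> ?t \<in> T"
      using t T_card by (intro inj_on_image_mem_iff[OF inj_on_image_Pow[OF h(1)]]) auto
    finally show ?thesis using T_iff_flag[OF xy] by simp
  qed
  moreover have "?F x = f x" if "x \<in> X" for x
    using that C(2) h(2)[of "f x"] by (auto simp: place_def)
  moreover have "lstrong M R (?F ` X') (?G ` Y')"
    using lstrong_realization[OF h(1,2,5,4)] .
  ultimately show ?thesis using X'Y' by (intro that[of ?F ?G]) (auto simp: partial_iso_def)
qed

text \<open>
  The free extension needs a strong pair as pattern and a strong set to grow from; both are
  obtained by passing to supersets of least predimension.
\<close>

lemma partial_iso_extend:
  assumes gen: "hrushovski_generic M R" and iso: "partial_iso M R X Y f g"
    and PQ: "finite P" "P \<subseteq> M" "finite Q" "Q \<subseteq> lines M"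
  obtains X' Y' f' g' where "partial_iso M R X' Y' f' g'" "X \<union> P \<subseteq> X'" "Y \<union> Q \<subseteq> Y'"
    "\<And>x. x \<in> X \<Longrightarrow> f' x = f x"
proof -
  have XY: "lstrong M R X Y" "lstrong M R (f ` X) (g ` Y)" using iso by (auto simp: partial_iso_def)
  obtain X' Y' where hull: "X \<union> P \<subseteq> X'" "Y \<union> Q \<subseteq> Y'" "lstrong M R X' Y'"
    by (rule lstrong_superset_exists[OF gen, of "X \<union> P" "Y \<union> Q"])
      (use PQ XY(1) in \<open>auto simp: lstrong_def\<close>)
  have "finite z" if "z \<in> g ` Y" for z
    using XY(2) that by (intro card_ge_0_finite) (auto simp: lstrong_def lines_def)
  hence "finite (\<Union> (g ` Y))" using XY(2) by (auto simp: lstrong_def)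
  moreover have "\<Union> (g ` Y) \<subseteq> M" using XY(2) by (auto simp: lstrong_def lines_def)
  ultimately obtain C where C: "f ` X \<union> \<Union> (g ` Y) \<subseteq> C" "strong R C M"
    using XY(2) strong_superset_exists[OF gen, of "f ` X \<union> \<Union> (g ` Y)"]
    by (auto simp: lstrong_def)
  interpret free_extension M R X X' C Y Y' f g
    using iso hull C XY generic_r_structure[OF gen]
    by unfold_locales (auto simp: partial_iso_def lstrong_def)
  show ?thesis
    by (rule realization_exists[OF gen hull(3)]) (use that hull in blast)
qed

text \<open>
  All values of the valuation, not only those of the free variables, lie in the finite set
  \<open>X\<close>. This is harmless, as a valuation with finite range stays one when a variable
  is updated, and it lets the induction over formulas ignore which variables are free.
\<close>

definition similar ::
  "'a set \<Rightarrow> ('a \<Rightarrow> 'a \<Rightarrow> 'a \<Rightarrow> bool) \<Rightarrow> (nat \<Rightarrow> 'a) \<Rightarrow> (nat \<Rightarrow> 'a) \<Rightarrow> bool" where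
  "similar M R v v' \<longleftrightarrow> (\<exists>X Y f g. partial_iso M R X Y f g \<and> range v \<subseteq> X \<and> v' = f \<circ> v)"

lemma similar_sym:
  assumes "similar M R v v'"
  shows "similar M R v' v"
proof -
  obtain X Y f g where *: "partial_iso M R X Y f g" "range v \<subseteq> X" "v' = f \<circ> v"
    using assms by (auto simp: similar_def)
  have "inj_on f X" using *(1) by (simp add: partial_iso_def)
  hence "v = inv_into X f \<circ> v'" using *(2,3) by (auto simp: fun_eq_iff image_subset_iff)
  moreover have "range v' \<subseteq> f ` X" using *(2,3) by auto
  ultimately show ?thesis using partial_iso_inverse[OF *(1)] unfolding similar_def by blast
qed

lemma similar_forth:
  assumes "hrushovski_generic M R" "similar M R v v'" "a \<in> M"
  shows "\<exists>a'\<in>M. similar M R (v(n := a)) (v'(n := a'))"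
proof -
  obtain X Y f g where *: "partial_iso M R X Y f g" "range v \<subseteq> X" "v' = f \<circ> v"
    using assms(2) by (auto simp: similar_def)
  obtain X' Y' f' g' where ext: "partial_iso M R X' Y' f' g'" "X \<union> {a} \<subseteq> X'"
      "\<And>x. x \<in> X \<Longrightarrow> f' x = f x"
    by (rule partial_iso_extend[OF assms(1) *(1), of "{a}" "{}"]) (use assms(3) in auto)
  have "f' a \<in> M" using ext(1,2) by (auto simp: partial_iso_def lstrong_def)
  moreover have "range (v(n := a)) \<subseteq> X'" using *(2) ext(2) by auto
  moreover have "v'(n := f' a) = f' \<circ> v(n := a)"
    using *(2,3) ext(3) by (auto simp: fun_eq_iff image_subset_iff)
  ultimately show ?thesis using ext(1) unfolding similar_def by blast
qed

lemma S_rel_iff_line: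
  assumes "r_structure M R"
  shows "S_rel M R x1 x2 x3 \<longleftrightarrow> x1 \<noteq> x2 \<and> x1 \<noteq> x3 \<and> x2 \<noteq> x3 \<and>
    (\<exists>y\<in>lines M. \<forall>x\<in>{x1, x2, x3}. insert x y \<in> triples R)" (is "_ \<longleftrightarrow> ?rhs")
proof
  assume "S_rel M R x1 x2 x3"
  then obtain x4 x5 where *: "x4 \<in> M" "x5 \<in> M" "R x1 x4 x5" "R x2 x4 x5" "R x3 x4 x5"
      "x1 \<noteq> x2" "x1 \<noteq> x3" "x2 \<noteq> x3"
    by (auto simp: S_rel_def)
  have "x4 \<noteq> x5" using assms *(3) unfolding r_structure_def by blast
  thus ?rhs using * by (intro conjI bexI[of _ "{x4, x5}"]) (auto simp: lines_def triple_iff[OF assms])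
next
  assume rhs: ?rhs
  then obtain y where y: "y \<in> lines M" "\<forall>x\<in>{x1, x2, x3}. insert x y \<in> triples R" by blast
  then obtain x4 x5 where x45: "y = {x4, x5}" by (auto simp: lines_def card_2_iff)
  have R: "R x1 x4 x5" "R x2 x4 x5" "R x3 x4 x5"
    using y(2) by (auto simp: x45 triple_iff[OF assms])
  moreover have "x1 \<in> M \<and> x2 \<in> M \<and> x3 \<in> M \<and> x4 \<in> M \<and> x5 \<in> M"
    using R assms unfolding r_structure_def by blast
  ultimately show "S_rel M R x1 x2 x3" using rhs by (auto simp: S_rel_def)
qed

text \<open>
  The witnessing line need not belong to the domain of the isomorphism, which therefore is first
  extended to that line.
\<close>

lemma similar_S_rel:
  assumes "hrushovski_generic M R" "similar M R v v'" "S_rel M R (v i) (v j) (v k)"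
  shows "S_rel M R (v' i) (v' j) (v' k)"
proof -
  have rM: "r_structure M R" using assms(1) by (simp add: hrushovski_generic_def)
  obtain X Y f g where *: "partial_iso M R X Y f g" "range v \<subseteq> X" "v' = f \<circ> v"
    using assms(2) by (auto simp: similar_def)
  obtain y where y: "y \<in> lines M" "\<forall>x\<in>{v i, v j, v k}. insert x y \<in> triples R"
    and ne: "v i \<noteq> v j" "v i \<noteq> v k" "v j \<noteq> v k"
    using assms(3) unfolding S_rel_iff_line[OF rM] by blast
  obtain X' Y' f' g' where ext: "partial_iso M R X' Y' f' g'" "X \<subseteq> X'" "y \<in> Y'"
      "\<And>x. x \<in> X \<Longrightarrow> f' x = f x"
    by (rule partial_iso_extend[OF assms(1) *(1), of "{}" "{y}"]) (use y(1) in auto)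
  have v': "v' l = f' (v l)" "v l \<in> X'" for l using *(2,3) ext(2,4) by (auto simp: image_subset_iff)
  have "g' y \<in> lines M" using ext(1,3) by (auto simp: partial_iso_def lstrong_def)
  moreover have "insert (v' l) (g' y) \<in> triples R \<longleftrightarrow> insert (v l) y \<in> triples R" for l
    using ext(1,3) v'(2)[of l] unfolding v'(1) partial_iso_def by blast
  moreover have "v' l = v' m \<longleftrightarrow> v l = v m" for l m
    using ext(1) v'(2) unfolding v'(1) partial_iso_def by (auto simp: inj_on_eq_iff)
  ultimately show ?thesis using y(2) ne unfolding S_rel_iff_line[OF rM] by auto
qed

lemma similar_sat:
  assumes gen: "hrushovski_generic M R" and "similar M R v v'"
  shows "sat M (S_rel M R) v \<phi> \<longleftrightarrow> sat M (S_rel M R) v' \<phi>"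
  using assms(2)
proof (induction \<phi> arbitrary: v v')
  case (FEq i j)
  then obtain X Y f g where *: "inj_on f X" "range v \<subseteq> X" "v' = f \<circ> v"
    by (auto simp: similar_def partial_iso_def)
  thus ?case by (auto simp: inj_on_eq_iff image_subset_iff)
next
  case (FRel i j k)
  thus ?case using similar_S_rel[OF gen] similar_sym by (metis sat.simps(2))
next
  case (FEx n \<phi>)
  have "sat M (S_rel M R) w' (FEx n \<phi>)"
    if "similar M R w w'" "sat M (S_rel M R) w (FEx n \<phi>)" for w w'
    using that similar_forth[OF gen that(1)] FEx.IH by (metis sat.simps(5))
  thus ?case using FEx.prems similar_sym by blast
next
  case (FNeg \<phi>)
  show ?case using FNeg.IH[OF FNeg.prems] by simp
next
  case (FConj \<phi> \<psi>)
  show ?case using FConj.IH[OF FConj.prems] by simp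
qed

text \<open>
  Within \<open>D\<close> a line is incident with at most one point, the remaining one, so the
  weight of the lines outweighs their incidences. Thus three related points, whose three
  incident lines carry one point each, are as strong as three unrelated ones.
\<close>

lemma lstrong_three_points:
  assumes "r_structure M R" "strong R D M" "card D = 3"
  shows "lstrong M R D {}"
proof -
  have D: "finite D" "D \<subseteq> M" using assms(2) by (auto simp: strong_def)
  have "ldim R D {} \<le> ldim R X Y"
    if XY: "finite X" "finite Y" "D \<subseteq> X" "X \<subseteq> M" "Y \<subseteq> lines M" for X Y
  proof -
    let ?Z = "Y \<inter> Pow D"
    have "inj_on snd (flags R D ?Z)"
    proof (rule inj_onI, clarify)
      fix x y x' y' assume *: "(x, y) \<in> flags R D ?Z" "(x', y') \<in> flags R D ?Z" "snd (x, y) = snd (x', y')"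
      hence "y' = y" "y \<in> lines M" using XY(5) by (auto simp: flags_def)
      hence "x \<notin> y" "x' \<notin> y" "card y = 2" "insert x y \<subseteq> D" "insert x' y \<subseteq> D"
        using * flag_point_notin_line[OF assms(1), of y] by (auto simp: flags_def lines_def)
      moreover from this have "insert x y = D" "insert x' y = D"
        using assms(3) by (simp_all add: card_subset_eq[OF D(1)] finite_subset[OF _ D(1)])
      ultimately show "x = x' \<and> y = y'" using \<open>y' = y\<close> by blast
    qed
    moreover have "snd ` flags R D ?Z \<subseteq> ?Z" by (auto simp: flags_def)
    ultimately have "card (flags R D ?Z) \<le> card ?Z" using XY(2) by (intro card_inj_on_le) auto
    hence "ldim R D {} \<le> ldim R D ?Z" by (simp add: ldim_def flags_def)
    also have "D = X \<inter> D" using XY(3) by auto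
    hence "ldim R D ?Z = ldim R (X \<inter> D) ?Z" by simp
    also have "\<dots> \<le> ldim R X Y" using assms(1,2) XY by (intro ldim_restrict_strong)
    finally show ?thesis .
  qed
  thus ?thesis using D by (auto simp: lstrong_def)
qed

section \<open>A related and an unrelated strong triple\<close>

text \<open>
  A three-element structure is in the class whether or not its elements are related, since the
  predimensions of its subsets are non-negative in both cases; so it occurs as a strong subset
  of \<open>M\<close>.
\<close>

lemma generic_strong_triple:
  assumes gen: "hrushovski_generic M R"
  obtains a b c where "a \<noteq> b" "a \<noteq> c" "b \<noteq> c" "strong R {a, b, c} M" "R a b c \<longleftrightarrow> related"
proof -
  let ?D = "{0, 1, 2 :: nat}"
  define T where "T = (if related then {?D} else {})"
  have T: "card t = 3 \<and> t \<subseteq> ?D" if "t \<in> T" for t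
    using that by (auto simp: T_def split: if_splits)
  have "{t \<in> triples R. t = {}} = {}"
    using triples_card(1)[OF generic_r_structure[OF gen]] by force
  hence old: "{t \<in> T. t \<subseteq> (\<lambda>_. 0) ` {}} = image (\<lambda>_. 0) ` {t \<in> triples R. t \<subseteq> {}}"
    using T by fastforce
  have new: "card {t \<in> T. t \<subseteq> U \<and> \<not> t \<subseteq> (\<lambda>_. 0) ` {}} \<le> card (U - (\<lambda>_. 0) ` {})" if U: "U \<subseteq> ?D" for U
  proof (cases "U = ?D")
    case False
    hence none: "{t \<in> T. t \<subseteq> U \<and> \<not> t \<subseteq> (\<lambda>_. 0) ` {}} = {}" using U by (auto simp: T_def)
    show ?thesis unfolding none by simp
  next
    case True
    have "{t \<in> T. t \<subseteq> U \<and> \<not> t \<subseteq> (\<lambda>_. 0) ` {}} \<subseteq> {?D}" by (auto simp: T_def)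
    hence "card {t \<in> T. t \<subseteq> U \<and> \<not> t \<subseteq> (\<lambda>_. 0) ` {}} \<le> 1" using card_mono[of "{?D}"] by fastforce
    thus ?thesis using True by simp
  qed
  have fin: "finite ?D" by simp
  have base: "inj_on (\<lambda>_. 0) ({} :: 'a set)" "(\<lambda>_. 0) ` ({} :: 'a set) \<subseteq> ?D" by simp_all
  obtain h where h: "inj_on h ?D" "{t \<in> triples R. t \<subseteq> h ` ?D} = image h ` T"
      "strong R (h ` ?D) M"
    by (rule generic_extension[OF gen generic_strong_empty[OF gen] fin T base old new])
      (assumption | rule that)+
  have "R (h 0) (h 1) (h 2) \<longleftrightarrow> h ` ?D \<in> {t \<in> triples R. t \<subseteq> h ` ?D}"
    using triple_iff[OF generic_r_structure[OF gen], of "h 0" "h 1" "h 2"] by simp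
  also have "\<dots> \<longleftrightarrow> related" unfolding h(2) by (auto simp: T_def)
  finally show ?thesis using h(1,3) by (intro that[of "h 0" "h 1" "h 2"]) (auto simp: inj_on_def)
qed

lemma definable_S_rel: "definable M R (S_rel M R)"
proof -
  \<comment> \<open>The bound variables 3 and 4 differ from the free variables 0, 1, 2 of the formula.\<close>
  let ?\<phi> = "FConj (FEx 3 (FEx 4 (FConj (FRel 0 3 4) (FConj (FRel 1 3 4) (FRel 2 3 4)))))
    (FConj (FNeg (FEq 0 1)) (FConj (FNeg (FEq 0 2)) (FNeg (FEq 1 2))))"
  have "S_rel M R (v 0) (v 1) (v 2) \<longleftrightarrow> sat M R v ?\<phi>" if "range v \<subseteq> M" for v
    using that by (auto simp: S_rel_def image_subset_iff)
  thus ?thesis unfolding definable_def by (intro exI[of _ ?\<phi>]) auto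
qed

theorem corollary5p8:
  fixes M :: "'a set" and R :: "'a \<Rightarrow> 'a \<Rightarrow> 'a \<Rightarrow> bool"
  assumes "hrushovski_generic M R"
  shows "definable M R (S_rel M R) \<and> \<not> definable M (S_rel M R) R"
proof
  show "\<not> definable M (S_rel M R) R"
  proof
    assume "definable M (S_rel M R) R"
    then obtain \<phi> where \<phi>: "\<And>v. range v \<subseteq> M \<Longrightarrow>
        R (v 0) (v 1) (v 2) \<longleftrightarrow> sat M (S_rel M R) v \<phi>"
      by (auto simp: definable_def)
    have rM: "r_structure M R" using assms by (rule generic_r_structure)
    obtain a b c where abc: "a \<noteq> b" "a \<noteq> c" "b \<noteq> c" "strong R {a, b, c} M" "R a b c"
      using generic_strong_triple[OF assms, of True] by blast
    obtain a' b' c' where abc': "a' \<noteq> b'" "a' \<noteq> c'" "b' \<noteq> c'" "strong R {a', b', c'} M"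
        "\<not> R a' b' c'"
      using generic_strong_triple[OF assms, of False] by blast
    define v where "v n = (if n = 0 then a else if n = 1 then b else c)" for n :: nat
    define f where "f x = (if x = a then a' else if x = b then b' else c')" for x
    have "lstrong M R {a, b, c} {}" "lstrong M R {a', b', c'} {}"
      using abc abc' by (auto intro!: lstrong_three_points[OF rM])
    moreover have "f ` {a, b, c} = {a', b', c'}" "inj_on f {a, b, c}"
      using abc abc' by (auto simp: f_def inj_on_def)
    ultimately have iso: "partial_iso M R {a, b, c} {} f id" by (simp add: partial_iso_def)
    have ranges: "range v \<subseteq> {a, b, c}" "range (f \<circ> v) \<subseteq> {a', b', c'}"
      by (auto simp: v_def f_def)
    have "similar M R v (f \<circ> v)" using iso ranges(1) unfolding similar_def by blast
    hence "sat M (S_rel M R) v \<phi> \<longleftrightarrow> sat M (S_rel M R) (f \<circ> v) \<phi>"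
      by (rule similar_sat[OF assms])
    moreover have "range v \<subseteq> M" "range (f \<circ> v) \<subseteq> M"
      using ranges abc(4) abc'(4) by (auto simp: strong_def)
    ultimately have "R (v 0) (v 1) (v 2) \<longleftrightarrow> R (f (v 0)) (f (v 1)) (f (v 2))"
      using \<phi>[of v] \<phi>[of "f \<circ> v"] by simp
    thus False using abc abc' by (simp add: v_def f_def)
  qed
qed (rule definable_S_rel)

end
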